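(* Let $A$ be the generator of a $C_0$-semigroup $e^{tA}$ on a Hilbert space $H$, $T>0$, $K\in L^2(0,T;\mathbb R)$, $\mu(t)=\int_0^te^{(t-s)A}K(s)\,ds$, $R$ the unique solution of $R(t)-\int_0^t\mu(t-s)R(s)\,ds=-\mu(t)$, and for $0\le\sigma\le\tau\le t\le T$ let $F(t,\tau)=e^{(t-\tau)A}-\int_\tau^tR(t-s)e^{(s-\tau)A}ds$, $G(t,\sigma,\tau)=\mu(t-\sigma)-e^{(t-\tau)A}\mu(\tau-\sigma)$, $M(t,\sigma,\tau)=G(t,\sigma,\tau)-\int_\tau^tR(t-s)G(s,\sigma,\tau)\,ds$. If $x\in\mathcal D(A)$, then $\partial_\tau M(t,\sigma,\tau)x$ exists and $\partial_\tau M(t,\sigma,\tau)x=-F(t,\tau)K(\tau-\sigma)x$.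
   Formalization: The derivative $\partial_\tau M(t,\sigma,\tau)x$ exists and equals $-F(t,\tau)K(\tau-\sigma)x$ only for almost every $\tau$ with $\sigma\le\tau\le t$, not for every such $\tau$, and is taken one-sided at the endpoints $\sigma$ and $t$. Apart from conventions, each condition added here is assumed in the paper as well or is needed for the statement above to hold. *)

theory Defs
  imports "HOL-Analysis.Analysis"
begin

definition C0_semigroup :: "(real \<Rightarrow> 'a::real_normed_vector \<Rightarrow>\<^sub>L 'a) \<Rightarrow> bool" where
  "C0_semigroup S \<longleftrightarrow>
     S 0 = id_blinfun \<and>
     (\<forall>s\<ge>0. \<forall>t\<ge>0. S (s + t) = S s o\<^sub>L S t) \<and>
     (\<forall>x. ((\<lambda>t. blinfun_apply (S t) x) \<longlongrightarrow> x) (at_right 0))"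

definition generator_domain :: "(real \<Rightarrow> 'a::real_normed_vector \<Rightarrow>\<^sub>L 'a) \<Rightarrow> 'a set" where
  "generator_domain S =
     {x. \<exists>y. ((\<lambda>h. (1 / h) *\<^sub>R (blinfun_apply (S h) x - x)) \<longlongrightarrow> y) (at_right 0)}"

definition generator :: "(real \<Rightarrow> 'a::real_normed_vector \<Rightarrow>\<^sub>L 'a) \<Rightarrow> 'a \<Rightarrow> 'a" where
  "generator S x = Lim (at_right 0) (\<lambda>h. (1 / h) *\<^sub>R (blinfun_apply (S h) x - x))"

definition mu_op :: "(real \<Rightarrow> 'a::real_normed_vector \<Rightarrow>\<^sub>L 'a) \<Rightarrow> (real \<Rightarrow> real) \<Rightarrow> real \<Rightarrow> 'a \<Rightarrow> 'a" where
  "mu_op S K t x = integral {0..t} (\<lambda>s. K s *\<^sub>R blinfun_apply (S (t - s)) x)"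

definition resolvent_eq ::
  "(real \<Rightarrow> 'a::real_normed_vector \<Rightarrow>\<^sub>L 'a) \<Rightarrow> (real \<Rightarrow> real) \<Rightarrow> real \<Rightarrow> (real \<Rightarrow> 'a \<Rightarrow>\<^sub>L 'a) \<Rightarrow> bool" where
  "resolvent_eq S K T R \<longleftrightarrow>
     (\<forall>t\<in>{0..T}. \<forall>x. blinfun_apply (R t) x
         - integral {0..t} (\<lambda>s. mu_op S K (t - s) (blinfun_apply (R s) x))
       = - mu_op S K t x)"

definition strongly_continuous_on :: "real set \<Rightarrow> (real \<Rightarrow> 'a::real_normed_vector \<Rightarrow>\<^sub>L 'a) \<Rightarrow> bool" where
  "strongly_continuous_on I R \<longleftrightarrow> (\<forall>x. continuous_on I (\<lambda>t. blinfun_apply (R t) x))"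

definition F_op :: "(real \<Rightarrow> 'a::real_normed_vector \<Rightarrow>\<^sub>L 'a) \<Rightarrow> (real \<Rightarrow> 'a \<Rightarrow>\<^sub>L 'a) \<Rightarrow> real \<Rightarrow> real \<Rightarrow> 'a \<Rightarrow> 'a" where
  "F_op S R t \<tau> x = blinfun_apply (S (t - \<tau>)) x
      - integral {\<tau>..t} (\<lambda>s. blinfun_apply (R (t - s)) (blinfun_apply (S (s - \<tau>)) x))"

definition G_op :: "(real \<Rightarrow> 'a::real_normed_vector \<Rightarrow>\<^sub>L 'a) \<Rightarrow> (real \<Rightarrow> real) \<Rightarrow> real \<Rightarrow> real \<Rightarrow> real \<Rightarrow> 'a \<Rightarrow> 'a" where
  "G_op S K t \<sigma> \<tau> x = mu_op S K (t - \<sigma>) x - blinfun_apply (S (t - \<tau>)) (mu_op S K (\<tau> - \<sigma>) x)"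

definition M_op :: "(real \<Rightarrow> 'a::real_normed_vector \<Rightarrow>\<^sub>L 'a) \<Rightarrow> (real \<Rightarrow> real) \<Rightarrow> (real \<Rightarrow> 'a \<Rightarrow>\<^sub>L 'a) \<Rightarrow> real \<Rightarrow> real \<Rightarrow> real \<Rightarrow> 'a \<Rightarrow> 'a" where
  "M_op S K R t \<sigma> \<tau> x = G_op S K t \<sigma> \<tau> x
      - integral {\<tau>..t} (\<lambda>s. blinfun_apply (R (t - s)) (G_op S K s \<sigma> \<tau> x))"

end

theory Submission
  imports Defs
begin

text \<open>
For \<sigma> \<le> \<tau>0 \<le> \<tau>1 \<le> t the semigroup law turns the definitions into the exact increment formula
  M(t,\<sigma>,\<tau>1)x - M(t,\<sigma>,\<tau>0)x = - F(t,\<tau>1) w + \<integral> R(t-s) G(s,\<sigma>,\<tau>0)x ds   (s from \<tau>0 to \<tau>1),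
  where w = \<mu>(\<tau>1-\<sigma>)x - e^((\<tau>1-\<tau>0)A) \<mu>(\<tau>0-\<sigma>)x = \<integral> K(u) e^((\<tau>1-\<sigma>-u)A)x du   (u from \<tau>0-\<sigma> to \<tau>1-\<sigma>).
Divided by h = \<tau>1 - \<tau>0, w/h tends to K(\<tau>-\<sigma>)x and the last integral is o(h) as soon as \<tau>-\<sigma>
is a Lebesgue point of K and of |K|. Since F(t,\<tau>) is bounded uniformly in \<tau> and strongly right
continuous in \<tau>, both one-sided difference quotients of M then tend to -F(t,\<tau>)K(\<tau>-\<sigma>)x, and almost
every point is a Lebesgue point.
\<close>

section \<open>Uniform boundedness\<close>

lemma closed_cover_contains_ball:
  fixes E :: "nat \<Rightarrow> 'a::complete_space set"
  assumes closed: "\<And>n. closed (E n)" and cover: "\<And>y. \<exists>n. y \<in> E n"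
  obtains n y e where "e > 0" "ball y e \<subseteq> E n"
proof -
  have "\<exists>n y e. e > 0 \<and> ball y e \<subseteq> E n"
  proof (rule ccontr)
    assume no_ball: "\<not> ?thesis"
    have empty_interior: "euclidean interior_of (E n) = {}" for n
    proof -
      have "\<not> (U \<subseteq> E n \<and> open U \<and> y \<in> U)" for U y
        using no_ball open_contains_ball by (metis subset_trans)
      then show ?thesis unfolding interior_of_def by auto
    qed
    have "euclidean interior_of \<Union>(range E) = {}"
      using closed empty_interior completely_metrizable_space_euclidean closed_closedin
      by (intro Baire_category_alt) auto
    moreover have "\<Union>(range E) = UNIV" using cover by blast
    ultimately show False by (metis interior_of_topspace topspace_euclidean UNIV_not_empty)
  qed
  then show thesis using that by blast
qed

lemma norm_blinfun_le_if_bounded_on_ball: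
  fixes L :: "'a::real_normed_vector \<Rightarrow>\<^sub>L 'b::real_normed_vector"
  assumes "e > 0" and bounded: "\<And>y. y \<in> ball y0 e \<Longrightarrow> norm (L y) \<le> c"
  shows "norm L \<le> 4 * c / e"
proof (rule norm_blinfun_bound)
  have "0 \<le> c" using bounded[of y0] \<open>e > 0\<close> by (meson centre_in_ball norm_ge_zero order_trans)
  then show "0 \<le> 4 * c / e" using \<open>e > 0\<close> by simp
  show "norm (L z) \<le> 4 * c / e * norm z" for z
  proof (cases "z = 0")
    case False
    define s where "s = (e / 2) / norm z"
    have "s > 0" using False \<open>e > 0\<close> by (simp add: s_def)
    have "y0 + s *\<^sub>R z \<in> ball y0 e" using False \<open>e > 0\<close> by (simp add: s_def dist_norm)
    then have "norm (L (y0 + s *\<^sub>R z)) \<le> c" "norm (L y0) \<le> c"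
      using bounded \<open>e > 0\<close> by auto
    then have "norm (L (y0 + s *\<^sub>R z) - L y0) \<le> c + c"
      by (meson add_mono norm_triangle_ineq4 order_trans)
    moreover have "L z = (1 / s) *\<^sub>R (L (y0 + s *\<^sub>R z) - L y0)"
      using \<open>s > 0\<close> by (simp add: blinfun.add_right blinfun.scaleR_right)
    ultimately have "norm (L z) \<le> (1 / s) * (c + c)"
      using \<open>s > 0\<close> by (simp add: divide_right_mono)
    then show ?thesis using False \<open>e > 0\<close> by (simp add: s_def field_simps)
  qed simp
qed

theorem uniform_boundedness:
  fixes L :: "'i \<Rightarrow> 'a::{real_normed_vector,complete_space} \<Rightarrow>\<^sub>L 'b::real_normed_vector"
  assumes pointwise: "\<And>y. bounded ((\<lambda>i. L i y) ` I)"
  shows "bounded (L ` I)"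
proof -
  define E where "E n = (\<Inter>i\<in>I. {y. norm (L i y) \<le> real n})" for n
  have "closed (E n)" for n
    unfolding E_def by (intro closed_INT ballI closed_Collect_le continuous_intros)
  moreover have "\<exists>n. y \<in> E n" for y
  proof -
    obtain c where "\<forall>i\<in>I. norm (L i y) \<le> c" using pointwise[of y] by (auto simp: bounded_iff)
    moreover obtain n where "c \<le> real n" using real_arch_simple by blast
    ultimately have "y \<in> E n" by (force simp: E_def)
    then show ?thesis by blast
  qed
  ultimately obtain n y0 e where "e > 0" "ball y0 e \<subseteq> E n" by (rule closed_cover_contains_ball)
  then have "norm (L i) \<le> 4 * real n / e" if "i \<in> I" for i
    using that by (intro norm_blinfun_le_if_bounded_on_ball) (auto simp: E_def)
  then show ?thesis by (auto simp: bounded_iff)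
qed

section \<open>Limits and one-sided difference quotients\<close>

lemma tendsto_apply_equi_lipschitz:
  fixes L :: "'i \<Rightarrow> 'a::real_normed_vector \<Rightarrow> 'b::real_normed_vector"
  assumes "((\<lambda>i. L i z) \<longlongrightarrow> l) F" and "(u \<longlongrightarrow> z) F"
    and "\<forall>\<^sub>F i in F. \<forall>y. norm (L i y - L i z) \<le> M * norm (y - z)"
  shows "((\<lambda>i. L i (u i)) \<longlongrightarrow> l) F"
proof -
  have "((\<lambda>i. L i (u i) - L i z) \<longlongrightarrow> 0) F"
  proof (rule Lim_null_comparison)
    show "\<forall>\<^sub>F i in F. norm (L i (u i) - L i z) \<le> M * norm (u i - z)"
      using assms(3) by eventually_elim blast
    show "((\<lambda>i. M * norm (u i - z)) \<longlongrightarrow> 0) F"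
      using tendsto_mult_right_zero[OF tendsto_norm_zero[OF LIM_zero[OF assms(2)]]] .
  qed
  from tendsto_add[OF this assms(1)] show ?thesis by simp
qed

lemma continuous_on_blinfun_apply_family:
  fixes L :: "'c::metric_space \<Rightarrow> 'a::real_normed_vector \<Rightarrow>\<^sub>L 'b::real_normed_vector"
  assumes "\<And>y. continuous_on A (\<lambda>s. L s y)" and "\<And>s. s \<in> A \<Longrightarrow> norm (L s) \<le> M"
    and "continuous_on A u"
  shows "continuous_on A (\<lambda>s. L s (u s))"
  unfolding continuous_on_def
proof
  fix x assume "x \<in> A"
  show "((\<lambda>s. L s (u s)) \<longlongrightarrow> L x (u x)) (at x within A)"
  proof (rule tendsto_apply_equi_lipschitz[where L="\<lambda>s. blinfun_apply (L s)" and M=M])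
    show "((\<lambda>s. L s (u x)) \<longlongrightarrow> L x (u x)) (at x within A)"
      using assms(1) \<open>x \<in> A\<close> by (simp add: continuous_on_def)
    show "(u \<longlongrightarrow> u x) (at x within A)"
      using assms(3) \<open>x \<in> A\<close> by (simp add: continuous_on_def)
    have "norm (L s y - L s (u x)) \<le> M * norm (y - u x)" if "s \<in> A" for s y
      using norm_blinfun[of "L s" "y - u x"] assms(2)[OF that]
      by (metis blinfun.diff_right mult_right_mono norm_ge_zero order_trans)
    then show "\<forall>\<^sub>F s in at x within A. \<forall>y. norm (L s y - L s (u x)) \<le> M * norm (y - u x)"
      by (auto simp: eventually_at_filter)
  qed
qed

lemma uniformly_continuous_on_real_ordered:
  fixes f :: "real \<Rightarrow> 'a::metric_space"
  assumes "\<And>e. e > 0 \<Longrightarrow> \<exists>d>0. \<forall>u\<in>A. \<forall>v\<in>A. v \<le> u \<longrightarrow> u - v < d \<longrightarrow> dist (f u) (f v) < e"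
  shows "uniformly_continuous_on A f"
  unfolding uniformly_continuous_on_def
proof (intro allI impI)
  fix e :: real assume "e > 0"
  then obtain d where "d > 0" and d: "\<forall>u\<in>A. \<forall>v\<in>A. v \<le> u \<longrightarrow> u - v < d \<longrightarrow> dist (f u) (f v) < e"
    using assms by blast
  show "\<exists>d>0. \<forall>x\<in>A. \<forall>x'\<in>A. dist x' x < d \<longrightarrow> dist (f x') (f x) < e"
  proof (intro exI[of _ d] conjI ballI impI)
    fix x x' assume x: "x \<in> A" "x' \<in> A" "dist x' x < d"
    show "dist (f x') (f x) < e"
    proof (cases "x \<le> x'")
      case True
      then show ?thesis using d x by (simp add: dist_real_def)
    next
      case False
      then have "dist (f x) (f x') < e" using d x by (simp add: dist_real_def)
      then show ?thesis by (simp add: dist_commute)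
    qed
  qed (rule \<open>d > 0\<close>)
qed

lemma has_vector_derivative_at_if_one_sided_quotients:
  fixes f :: "real \<Rightarrow> 'a::real_normed_vector"
  assumes right: "((\<lambda>h. (f (x + h) - f x) /\<^sub>R h) \<longlongrightarrow> D) (at_right 0)"
    and left: "((\<lambda>h. (f x - f (x - h)) /\<^sub>R h) \<longlongrightarrow> D) (at_right 0)"
  shows "(f has_vector_derivative D) (at x)"
proof -
  define g where "g y = (f y - f x - (y - x) *\<^sub>R D) /\<^sub>R norm (y - x)" for y
  have "((\<lambda>h. g (h + x)) \<longlongrightarrow> 0) (at_right 0)"
  proof (rule Lim_transform_eventually)
    show "((\<lambda>h. (f (x + h) - f x) /\<^sub>R h - D) \<longlongrightarrow> 0) (at_right 0)"
      using LIM_zero[OF right] .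
    show "\<forall>\<^sub>F h in at_right 0. (f (x + h) - f x) /\<^sub>R h - D = g (h + x)"
      by (auto simp: eventually_at_right_field g_def algebra_simps intro: exI[of _ 1])
  qed
  moreover have "((\<lambda>h. g (- (h + - x))) \<longlongrightarrow> 0) (at_right 0)"
  proof (rule Lim_transform_eventually)
    show "((\<lambda>h. - ((f x - f (x - h)) /\<^sub>R h - D)) \<longlongrightarrow> 0) (at_right 0)"
      using tendsto_minus[OF LIM_zero[OF left]] by simp
    show "\<forall>\<^sub>F h in at_right 0. - ((f x - f (x - h)) /\<^sub>R h - D) = g (- (h + - x))"
      by (auto simp: eventually_at_right_field g_def algebra_simps intro: exI[of _ 1])
  qed
  ultimately have "(g \<longlongrightarrow> 0) (at x)"
    by (simp add: filterlim_at_split filterlim_at_right_to_0[of g _ x]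
        filterlim_at_left_to_right[of g _ x] filterlim_at_right_to_0[of _ _ "- x"])
  then show ?thesis
    unfolding has_vector_derivative_def has_derivative_at_within g_def
    by (simp add: bounded_linear_scaleR_left)
qed

section \<open>Real integrable functions and Lebesgue points\<close>

lemma absolutely_integrable_if_square_integrable:
  fixes K :: "real \<Rightarrow> real"
  assumes "K measurable_on {a..b}" and "(\<lambda>s. (K s)\<^sup>2) integrable_on {a..b}"
  shows "K absolutely_integrable_on {a..b}"
proof (rule measurable_bounded_by_integrable_imp_absolutely_integrable)
  show "K \<in> borel_measurable (lebesgue_on {a..b})"
    using measurable_on_iff_borel_measurable[of "{a..b}" K] assms(1) by simp
  show "(\<lambda>s. (K s)\<^sup>2 + 1) integrable_on {a..b}"
    using integrable_add[OF assms(2) integrable_const_ivl[of "1::real" a b]] by simp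
  show "norm (K s) \<le> (K s)\<^sup>2 + 1" for s
  proof -
    have "0 \<le> (\<bar>K s\<bar> - 1)\<^sup>2" by simp
    then show ?thesis by (simp add: power2_diff power2_abs)
  qed
qed simp

lemma integral_over_short_intervals_small:
  fixes g :: "real \<Rightarrow> real"
  assumes "g integrable_on {a..b}" and "e > 0"
  obtains d where "d > 0"
    "\<And>u v. a \<le> v \<Longrightarrow> v \<le> u \<Longrightarrow> u \<le> b \<Longrightarrow> u - v < d \<Longrightarrow> \<bar>integral {v..u} g\<bar> < e"
proof -
  define G where "G x = integral {a..x} g" for x
  have "uniformly_continuous_on {a..b} G"
    unfolding G_def using assms(1)
    by (intro compact_uniformly_continuous indefinite_integral_continuous_1) auto
  then obtain d where "d > 0" and d: "\<And>x x'. x \<in> {a..b} \<Longrightarrow> x' \<in> {a..b} \<Longrightarrow> dist x' x < d \<Longrightarrow> dist (G x') (G x) < e"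
    using \<open>e > 0\<close> unfolding uniformly_continuous_on_def by metis
  have "\<bar>integral {v..u} g\<bar> < e" if "a \<le> v" "v \<le> u" "u \<le> b" "u - v < d" for u v
  proof -
    have "G u = G v + integral {v..u} g"
      unfolding G_def using that assms(1)
      by (intro Henstock_Kurzweil_Integration.integral_combine[symmetric])
        (auto intro: integrable_subinterval_real)
    then show ?thesis using d[of v u] that by (simp add: dist_real_def)
  qed
  with \<open>d > 0\<close> that show thesis by blast
qed

lemma right_lebesgue_points_real:
  fixes f :: "real \<Rightarrow> real"
  assumes "\<And>a b. f integrable_on {a..b}"
  obtains N where "negligible N"
    "\<And>x. x \<notin> N \<Longrightarrow> ((\<lambda>h. integral {x..x + h} f / h) \<longlongrightarrow> f x) (at_right 0)"
proof -
  obtain N where "negligible N" and N: "\<And>x e. \<lbrakk>x \<notin> N; 0 < e\<rbrakk> \<Longrightarrow> \<exists>d>0. \<forall>h. 0 < h \<and> h < d \<longrightarrow>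
      norm (integral (cbox x (x + h *\<^sub>R One)) f /\<^sub>R h ^ DIM(real) - f x) < e"
    using integrable_ccontinuous_explicit[of f] assms by (metis box_real(2))
  have "((\<lambda>h. integral {x..x + h} f / h) \<longlongrightarrow> f x) (at_right 0)" if "x \<notin> N" for x
    unfolding tendsto_iff eventually_at_right_field
  proof (intro allI impI)
    fix e :: real assume "0 < e"
    with N[OF that this] show "\<exists>b>0. \<forall>h>0. h < b \<longrightarrow> dist (integral {x..x + h} f / h) (f x) < e"
      by (simp add: dist_real_def divide_inverse_commute) blast
  qed
  with \<open>negligible N\<close> that show thesis by blast
qed

lemma lebesgue_differentiation_real:
  fixes f :: "real \<Rightarrow> real"
  assumes "f integrable_on {a..b}"
  obtains N where "negligible N"
    "\<And>x. x \<in> {a<..<b} - N \<Longrightarrow> ((\<lambda>h. integral {x..x + h} f / h) \<longlongrightarrow> f x) (at_right 0)"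
    "\<And>x. x \<in> {a<..<b} - N \<Longrightarrow> ((\<lambda>h. integral {x - h..x} f / h) \<longlongrightarrow> f x) (at_right 0)"
proof -
  define g where "g x = (if x \<in> {a..b} then f x else 0)" for x
  have "g integrable_on UNIV"
    unfolding g_def using assms integrable_restrict_UNIV by blast
  then have g_int: "g integrable_on {c..d}" for c d
    by (metis box_real(2) integrable_on_subcbox subset_UNIV)
  obtain N1 where "negligible N1" and N1:
    "\<And>x. x \<notin> N1 \<Longrightarrow> ((\<lambda>h. integral {x..x + h} g / h) \<longlongrightarrow> g x) (at_right 0)"
    using right_lebesgue_points_real[of g] g_int by blast
  txt \<open>Left-sided limits at x are right-sided limits of the reflected function at -x.\<close>
  have "(\<lambda>u. g (- u)) integrable_on {c..d}" for c d
    using Henstock_Kurzweil_Integration.integrable_reflect_real[where a="- d" and b="- c" and f=g] g_int by simp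
  then obtain N2 where "negligible N2" and N2:
    "\<And>x. x \<notin> N2 \<Longrightarrow> ((\<lambda>h. integral {x..x + h} (\<lambda>u. g (- u)) / h) \<longlongrightarrow> g (- x)) (at_right 0)"
    using right_lebesgue_points_real[of "\<lambda>u. g (- u)"] by blast
  show thesis
  proof
    show "negligible (N1 \<union> uminus ` N2)"
      using \<open>negligible N1\<close> \<open>negligible N2\<close>
      by (auto intro: negligible_differentiable_image_negligible derivative_intros)
    fix x assume x: "x \<in> {a<..<b} - (N1 \<union> uminus ` N2)"
    have inside: "\<forall>\<^sub>F h in at_right 0. {x - h..x + h} \<subseteq> {a..b}"
      using x unfolding eventually_at_right_field by (intro exI[of _ "min (x - a) (b - x)"]) auto
    have "g x = f x" using x by (simp add: g_def)
    show "((\<lambda>h. integral {x..x + h} f / h) \<longlongrightarrow> f x) (at_right 0)"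
    proof (rule Lim_transform_eventually)
      show "((\<lambda>h. integral {x..x + h} g / h) \<longlongrightarrow> f x) (at_right 0)"
        using N1[of x] x \<open>g x = f x\<close> by auto
      show "\<forall>\<^sub>F h in at_right 0. integral {x..x + h} g / h = integral {x..x + h} f / h"
        using inside by eventually_elim (auto simp: g_def intro!: integral_cong)
    qed
    show "((\<lambda>h. integral {x - h..x} f / h) \<longlongrightarrow> f x) (at_right 0)"
    proof (rule Lim_transform_eventually)
      have "- x \<notin> N2" using x by force
      then show "((\<lambda>h. integral {- x..- x + h} (\<lambda>u. g (- u)) / h) \<longlongrightarrow> f x) (at_right 0)"
        using N2[of "- x"] \<open>g x = f x\<close> by auto
      have reflect: "integral {- x..- x + h} (\<lambda>u. g (- u)) = integral {x - h..x} g" for h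
        using Henstock_Kurzweil_Integration.integral_reflect_real[where a="x - h" and b=x and f=g] by simp
      show "\<forall>\<^sub>F h in at_right 0. integral {- x..- x + h} (\<lambda>u. g (- u)) / h = integral {x - h..x} f / h"
        using inside by eventually_elim (simp only: reflect, auto simp: g_def intro!: integral_cong)
    qed
  qed
qed

section \<open>Integrals of Hilbert-space-valued functions\<close>

text \<open>The library states continuity-implies-integrability, additivity over adjacent intervals and
the norm bound for integrals for sort banach, which a type of sort {real_inner, complete_space} does
not have. They are recovered here from the Cauchy criterion and, via the inner product, from the
real-valued case.\<close>

text \<open>A weighted variant of the library's operative_approximableI.\<close>

lemma operative_weighted_approximable:
  fixes f :: "'b::euclidean_space \<Rightarrow> 'a::{real_normed_vector,complete_space}" and w :: "'b \<Rightarrow> real"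
  assumes "0 \<le> e" and w: "\<And>x. 0 \<le> w x"
  shows "operative conj True (\<lambda>i. \<exists>g. (\<forall>x\<in>i. norm (f x - g (x::'b)) \<le> e * w x) \<and> g integrable_on i)"
proof -
  interpret comm_monoid conj True
    by standard auto
  show ?thesis
  proof (standard, safe)
    fix a b :: 'b
    show "\<exists>g. (\<forall>x\<in>cbox a b. norm (f x - g x) \<le> e * w x) \<and> g integrable_on cbox a b"
      if "box a b = {}" for a b
      using assms that
      by (metis content_eq_0_interior integrable_on_null interior_cbox norm_zero right_minus_eq mult_nonneg_nonneg)
    {
      fix c g and k :: 'b
      assume fg: "\<forall>x\<in>cbox a b. norm (f x - g x) \<le> e * w x" and g: "g integrable_on cbox a b"
      assume k: "k \<in> Basis"
      show "\<exists>g. (\<forall>x\<in>cbox a b \<inter> {x. x \<bullet> k \<le> c}. norm (f x - g x) \<le> e * w x) \<and> g integrable_on cbox a b \<inter> {x. x \<bullet> k \<le> c}"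
           "\<exists>g. (\<forall>x\<in>cbox a b \<inter> {x. c \<le> x \<bullet> k}. norm (f x - g x) \<le> e * w x) \<and> g integrable_on cbox a b \<inter> {x. c \<le> x \<bullet> k}"
        using fg g k by auto
    }
    show "\<exists>g. (\<forall>x\<in>cbox a b. norm (f x - g x) \<le> e * w x) \<and> g integrable_on cbox a b"
      if fg1: "\<forall>x\<in>cbox a b \<inter> {x. x \<bullet> k \<le> c}. norm (f x - g1 x) \<le> e * w x"
        and g1: "g1 integrable_on cbox a b \<inter> {x. x \<bullet> k \<le> c}"
        and fg2: "\<forall>x\<in>cbox a b \<inter> {x. c \<le> x \<bullet> k}. norm (f x - g2 x) \<le> e * w x"
        and g2: "g2 integrable_on cbox a b \<inter> {x. c \<le> x \<bullet> k}"
        and k: "k \<in> Basis"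
      for c k g1 g2
    proof -
      let ?g = "\<lambda>x. if x\<bullet>k = c then f x else if x\<bullet>k \<le> c then g1 x else g2 x"
      show "\<exists>g. (\<forall>x\<in>cbox a b. norm (f x - g x) \<le> e * w x) \<and> g integrable_on cbox a b"
      proof (intro exI conjI ballI)
        show "norm (f x - ?g x) \<le> e * w x" if "x \<in> cbox a b" for x
          using assms by (auto simp: that fg1 fg2)
        show "?g integrable_on cbox a b"
        proof -
          have "?g integrable_on cbox a b \<inter> {x. x \<bullet> k \<le> c}" "?g integrable_on cbox a b \<inter> {x. x \<bullet> k \<ge> c}"
            by (rule integrable_spike[OF _ negligible_standard_hyperplane[of k c]], use k g1 g2 in auto)+
          with has_integral_split[OF _ _ k] show ?thesis
            unfolding integrable_on_def by blast
        qed
      qed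
    qed
  qed
qed

lemma weighted_approximable_on_division:
  fixes f :: "'b::euclidean_space \<Rightarrow> 'a::{real_normed_vector,complete_space}"
  assumes "0 \<le> e" and w: "\<And>x. 0 \<le> w x"
    and d: "d division_of (cbox a b)"
    and f: "\<forall>i\<in>d. \<exists>g. (\<forall>x\<in>i. norm (f x - g x) \<le> e * w x) \<and> g integrable_on i"
  obtains g where "\<forall>x\<in>cbox a b. norm (f x - g x) \<le> e * w x" "g integrable_on cbox a b"
proof -
  interpret operative conj True "\<lambda>i. \<exists>g. (\<forall>x\<in>i. norm (f x - g (x::'b)) \<le> e * w x) \<and> g integrable_on i"
    using \<open>0 \<le> e\<close> w by (rule operative_weighted_approximable)
  from f local.division [OF d] that show thesis
    by auto
qed

lemma weighted_approximation_scaleR_continuous: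
  fixes f :: "'n::euclidean_space \<Rightarrow> 'a::{real_normed_vector,complete_space}" and K :: "'n \<Rightarrow> real"
  assumes K: "K integrable_on cbox a b" and f: "continuous_on (cbox a b) f" and "e > 0"
  obtains g where "\<forall>x\<in>cbox a b. norm (K x *\<^sub>R f x - g x) \<le> e * \<bar>K x\<bar>" "g integrable_on cbox a b"
proof -
  obtain d where "0 < d" and d: "\<And>x x'. \<lbrakk>x \<in> cbox a b; x' \<in> cbox a b; dist x' x < d\<rbrakk> \<Longrightarrow> dist (f x') (f x) < e"
    using compact_uniformly_continuous[OF f compact_cbox] \<open>e > 0\<close>
    unfolding uniformly_continuous_on_def by metis
  obtain p where p: "p tagged_division_of cbox a b" and fine: "(\<lambda>x. ball x d) fine p"
    using fine_division_exists[OF gauge_ball[OF \<open>0 < d\<close>], of a b] .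
  have "\<exists>g. (\<forall>y\<in>l. norm (K y *\<^sub>R f y - g y) \<le> e * \<bar>K y\<bar>) \<and> g integrable_on l"
    if "(x, l) \<in> p" for x l
  proof (intro exI conjI ballI)
    obtain u v where l: "l = cbox u v" and "l \<subseteq> cbox a b" and "x \<in> l"
      using p \<open>(x, l) \<in> p\<close> by (meson tagged_division_ofD)
    show "(\<lambda>y. K y *\<^sub>R f x) integrable_on l"
      using integrable_on_subcbox[OF K] \<open>l \<subseteq> cbox a b\<close> l by (auto intro: integrable_on_scaleR_left)
    fix y assume "y \<in> l"
    then have "dist (f y) (f x) < e"
      using fine that d \<open>x \<in> l\<close> \<open>l \<subseteq> cbox a b\<close> by (fastforce simp: fine_def dist_commute)
    then have "\<bar>K y\<bar> * norm (f y - f x) \<le> \<bar>K y\<bar> * e"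
      by (intro mult_left_mono) (auto simp: dist_norm)
    then show "norm (K y *\<^sub>R f y - K y *\<^sub>R f x) \<le> e * \<bar>K y\<bar>"
      by (simp add: scaleR_diff_right[symmetric] mult.commute)
  qed
  then have pieces: "\<forall>l\<in>snd ` p. \<exists>g. (\<forall>y\<in>l. norm (K y *\<^sub>R f y - g y) \<le> e * \<bar>K y\<bar>) \<and> g integrable_on l"
    by force
  show thesis
    using weighted_approximable_on_division[where w="\<lambda>x. \<bar>K x\<bar>" and f="\<lambda>x. K x *\<^sub>R f x",
        OF _ _ division_of_tagged_division[OF p] pieces] \<open>e > 0\<close> that
    by auto
qed

lemma riemann_sum_diff_le_weighted:
  fixes F G :: "'n::euclidean_space \<Rightarrow> 'a::real_normed_vector"
  assumes D: "D tagged_division_of cbox a b" and "0 \<le> c"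
    and le: "\<And>x. x \<in> cbox a b \<Longrightarrow> norm (F x - G x) \<le> c * w x"
  shows "norm ((\<Sum>(x,k)\<in>D. measure lborel k *\<^sub>R F x) - (\<Sum>(x,k)\<in>D. measure lborel k *\<^sub>R G x))
         \<le> c * (\<Sum>(x,k)\<in>D. measure lborel k *\<^sub>R w x)"
proof -
  have "norm ((\<Sum>(x,k)\<in>D. measure lborel k *\<^sub>R F x) - (\<Sum>(x,k)\<in>D. measure lborel k *\<^sub>R G x))
      = norm (\<Sum>(x,k)\<in>D. measure lborel k *\<^sub>R (F x - G x))"
    by (simp add: sum_subtractf[symmetric] case_prod_unfold scaleR_diff_right)
  also have "\<dots> \<le> (\<Sum>(x,k)\<in>D. measure lborel k * norm (F x - G x))"
    by (rule order_trans[OF norm_sum]) (simp add: case_prod_unfold)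
  also have "\<dots> \<le> (\<Sum>(x,k)\<in>D. c * (measure lborel k *\<^sub>R w x))"
  proof (rule sum_mono, clarify)
    fix x k assume "(x, k) \<in> D"
    then have "x \<in> cbox a b" using D by (meson tagged_division_ofD subsetD)
    then show "measure lborel k * norm (F x - G x) \<le> c * (measure lborel k *\<^sub>R w x)"
      using mult_left_mono[OF le measure_nonneg] by (simp add: mult.left_commute)
  qed
  also have "\<dots> = c * (\<Sum>(x,k)\<in>D. measure lborel k *\<^sub>R w x)"
    by (simp add: sum_distrib_left case_prod_unfold)
  finally show ?thesis .
qed

lemma integrable_weighted_uniform_limit:
  fixes f :: "'n::euclidean_space \<Rightarrow> 'a::{real_normed_vector,complete_space}"
  assumes w: "w integrable_on cbox a b"
    and approx: "\<And>e. e > 0 \<Longrightarrow> \<exists>g. (\<forall>x\<in>cbox a b. norm (f x - g x) \<le> e * w x) \<and> g integrable_on cbox a b"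
  shows "f integrable_on cbox a b"
  unfolding integrable_Cauchy
proof (intro allI impI)
  fix e :: real assume "e > 0"
  let ?sum = "\<lambda>D h. \<Sum>(x,k)\<in>D. measure lborel k *\<^sub>R h x"
  define W where "W = integral (cbox a b) w"
  define e1 where "e1 = e / (4 * (\<bar>W\<bar> + 1))"
  have "e1 > 0" using \<open>e > 0\<close> by (simp add: e1_def add_nonneg_pos)
  then obtain g where g: "\<forall>x\<in>cbox a b. norm (f x - g x) \<le> e1 * w x" "g integrable_on cbox a b"
    using approx by blast
  obtain \<gamma>1 where "gauge \<gamma>1" and \<gamma>1: "\<And>D1 D2. D1 tagged_division_of cbox a b \<and> \<gamma>1 fine D1 \<and>
      D2 tagged_division_of cbox a b \<and> \<gamma>1 fine D2 \<Longrightarrow> norm (?sum D1 g - ?sum D2 g) < e / 2"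
    using g(2) \<open>e > 0\<close> unfolding integrable_Cauchy by (meson half_gt_zero)
  obtain \<gamma>0 where "gauge \<gamma>0" and \<gamma>0: "\<And>D. D tagged_division_of cbox a b \<and> \<gamma>0 fine D \<Longrightarrow>
      norm (?sum D w - W) < 1"
    using w unfolding W_def has_integral_integral has_integral by (meson zero_less_one)
  have close: "norm (?sum D f - ?sum D g) \<le> e / 4" if "D tagged_division_of cbox a b" "\<gamma>0 fine D" for D
  proof -
    have "norm (?sum D f - ?sum D g) \<le> e1 * ?sum D w"
      by (rule riemann_sum_diff_le_weighted[OF that(1)]) (use g(1) \<open>e1 > 0\<close> in auto)
    also have "\<dots> \<le> e1 * (\<bar>W\<bar> + 1)"
      using \<gamma>0[of D] that \<open>e1 > 0\<close> by (intro mult_left_mono) (auto simp: real_norm_def)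
    also have "\<dots> = e / 4"
      unfolding e1_def by (simp add: field_simps add_nonneg_pos)
    finally show ?thesis .
  qed
  show "\<exists>\<gamma>. gauge \<gamma> \<and> (\<forall>D1 D2. D1 tagged_division_of cbox a b \<and> \<gamma> fine D1 \<and>
      D2 tagged_division_of cbox a b \<and> \<gamma> fine D2 \<longrightarrow> norm (?sum D1 f - ?sum D2 f) < e)"
  proof (intro exI conjI allI impI)
    show "gauge (\<lambda>x. \<gamma>0 x \<inter> \<gamma>1 x)" using \<open>gauge \<gamma>0\<close> \<open>gauge \<gamma>1\<close> by (rule gauge_Int)
    fix D1 D2 assume D: "D1 tagged_division_of cbox a b \<and> (\<lambda>x. \<gamma>0 x \<inter> \<gamma>1 x) fine D1 \<and>
        D2 tagged_division_of cbox a b \<and> (\<lambda>x. \<gamma>0 x \<inter> \<gamma>1 x) fine D2"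
    then have "norm (?sum D1 f - ?sum D1 g) \<le> e / 4" "norm (?sum D2 f - ?sum D2 g) \<le> e / 4"
      and "norm (?sum D1 g - ?sum D2 g) < e / 2"
      using close \<gamma>1 by (auto simp: fine_Int)
    then show "norm (?sum D1 f - ?sum D2 f) < e"
      using norm_triangle_ineq4[of "?sum D1 f - ?sum D1 g" "?sum D2 f - ?sum D2 g"]
        norm_triangle_ineq[of "?sum D1 f - ?sum D1 g - (?sum D2 f - ?sum D2 g)" "?sum D1 g - ?sum D2 g"]
      by (simp add: algebra_simps)
  qed
qed

lemma integrable_scaleR_continuous:
  fixes f :: "'n::euclidean_space \<Rightarrow> 'a::{real_normed_vector,complete_space}" and K :: "'n \<Rightarrow> real"
  assumes "K absolutely_integrable_on cbox a b" and "continuous_on (cbox a b) f"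
  shows "(\<lambda>x. K x *\<^sub>R f x) integrable_on cbox a b"
proof (rule integrable_weighted_uniform_limit)
  show "(\<lambda>x. \<bar>K x\<bar>) integrable_on cbox a b"
    using assms(1) by (simp add: absolutely_integrable_on_def)
  show "\<exists>g. (\<forall>x\<in>cbox a b. norm (K x *\<^sub>R f x - g x) \<le> e * \<bar>K x\<bar>) \<and> g integrable_on cbox a b"
    if "e > 0" for e
    using weighted_approximation_scaleR_continuous[OF _ assms(2) that] assms(1)
    by (metis absolutely_integrable_on_def)
qed

corollary integrable_continuous_complete:
  fixes f :: "'n::euclidean_space \<Rightarrow> 'a::{real_normed_vector,complete_space}"
  assumes "continuous_on (cbox a b) f"
  shows "f integrable_on cbox a b"
  using integrable_scaleR_continuous[where K="\<lambda>_. 1" and f=f] assms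
  by (simp add: absolutely_integrable_on_def integrable_const)

lemma integral_combine_inner:
  fixes f :: "real \<Rightarrow> 'a::real_inner"
  assumes "a \<le> c" "c \<le> b"
    and "f integrable_on {a..b}" "f integrable_on {a..c}" "f integrable_on {c..b}"
  shows "integral {a..b} f = integral {a..c} f + integral {c..b} f"
proof -
  have eq: "v \<bullet> integral {a..b} f = v \<bullet> (integral {a..c} f + integral {c..b} f)" for v
  proof -
    have "v \<bullet> integral I f = integral I (\<lambda>x. v \<bullet> f x)" if "f integrable_on I" for I
      using integral_linear[OF that bounded_linear_inner_right[of v]] by (simp add: o_def)
    moreover have "(\<lambda>x. v \<bullet> f x) integrable_on {a..b}"
      using integrable_linear[OF assms(3) bounded_linear_inner_right[of v]] by (simp add: o_def)
    ultimately show ?thesis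
      using Henstock_Kurzweil_Integration.integral_combine[OF assms(1,2), of "\<lambda>x. v \<bullet> f x"] assms(3-5)
      by (simp add: inner_add_right)
  qed
  define d where "d = integral {a..b} f - (integral {a..c} f + integral {c..b} f)"
  have "d \<bullet> d = d \<bullet> integral {a..b} f - d \<bullet> (integral {a..c} f + integral {c..b} f)"
    by (metis d_def inner_diff_right)
  then have "d \<bullet> d = 0" using eq[of d] by simp
  then show ?thesis by (simp add: d_def)
qed

lemma integral_norm_bound_integral_inner:
  fixes f :: "'n::euclidean_space \<Rightarrow> 'a::real_inner"
  assumes "f integrable_on S" "g integrable_on S" and le: "\<And>x. x \<in> S \<Longrightarrow> norm (f x) \<le> g x"
  shows "norm (integral S f) \<le> integral S g"
proof -
  define v where "v = integral S f"
  have "(norm v)\<^sup>2 = integral S (\<lambda>x. v \<bullet> f x)"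
    using integral_linear[OF assms(1) bounded_linear_inner_right[of v]]
    by (simp add: o_def v_def power2_norm_eq_inner)
  also have "\<dots> \<le> integral S (\<lambda>x. norm v * g x)"
  proof (rule integral_le)
    show "(\<lambda>x. v \<bullet> f x) integrable_on S"
      using integrable_linear[OF assms(1) bounded_linear_inner_right[of v]] by (simp add: o_def)
    show "(\<lambda>x. norm v * g x) integrable_on S" using assms(2) by (rule integrable_on_mult_right)
    show "v \<bullet> f x \<le> norm v * g x" if "x \<in> S" for x
      using Cauchy_Schwarz_ineq2[of v "f x"] le[OF that] by (meson abs_le_D1 mult_left_mono norm_ge_zero order_trans)
  qed
  also have "\<dots> = norm v * integral S g" by simp
  finally have "norm v * norm v \<le> norm v * integral S g" by (simp add: power2_eq_square)
  moreover have "0 \<le> integral S g"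
    using assms(2) le norm_ge_zero order_trans by (blast intro: integral_nonneg)
  ultimately show ?thesis
    unfolding v_def[symmetric] by (cases "v = 0") auto
qed

section \<open>Strongly continuous semigroups\<close>

lemma C0_semigroupD:
  assumes "C0_semigroup S"
  shows C0_semigroup_zero: "S 0 = id_blinfun"
    and C0_semigroup_add: "\<And>s t. 0 \<le> s \<Longrightarrow> 0 \<le> t \<Longrightarrow> S (s + t) = S s o\<^sub>L S t"
    and C0_semigroup_tendsto: "\<And>y. ((\<lambda>t. S t y) \<longlongrightarrow> y) (at_right 0)"
  using assms by (auto simp: C0_semigroup_def)

lemma C0_semigroup_locally_bounded:
  fixes S :: "real \<Rightarrow> 'a::{real_normed_vector,complete_space} \<Rightarrow>\<^sub>L 'a"
  assumes "C0_semigroup S"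
  obtains \<delta> M where "\<delta> > 0" "\<And>u. u \<in> {0..\<delta>} \<Longrightarrow> norm (S u) \<le> M"
proof -
  have "\<exists>n. \<forall>u\<in>{0..inverse (real (Suc n))}. norm (S u) \<le> real n"
  proof (rule ccontr)
    assume "\<not> ?thesis"
    then have "\<forall>n. \<exists>v. v \<in> {0..inverse (real (Suc n))} \<and> real n < norm (S v)"
      by (meson not_le)
    then obtain u where u: "\<And>n. u n \<in> {0..inverse (real (Suc n))}" "\<And>n. real n < norm (S (u n))"
      by metis
    have "u \<longlonglongrightarrow> 0"
      using u(1) by (intro tendsto_sandwich[OF _ _ tendsto_const LIMSEQ_inverse_real_of_nat]) auto
    moreover have "continuous (at 0 within {0..}) (\<lambda>t. S t y)" for y
      using C0_semigroupD[OF assms] by (simp add: continuous_within at_within_Ici_at_right)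
    ultimately have "(\<lambda>n. S (u n) y) \<longlonglongrightarrow> y" for y
      using u(1) C0_semigroup_zero[OF assms]
      by (auto simp: continuous_within_sequentially o_def)
    then have "bounded ((\<lambda>n. S (u n)) ` UNIV)"
      by (intro uniform_boundedness) (use convergent_imp_bounded in blast)
    then obtain M where "\<And>n. norm (S (u n)) \<le> M" by (auto simp: bounded_iff)
    moreover obtain n where "M \<le> real n" using real_arch_simple by blast
    ultimately show False using u(2)[of n] by (meson order_trans not_le)
  qed
  then obtain n where "\<forall>u\<in>{0..inverse (real (Suc n))}. norm (S u) \<le> real n" by blast
  then show thesis using that[of "inverse (real (Suc n))" "real n"] by simp
qed

lemma C0_semigroup_bounded_on:
  fixes S :: "real \<Rightarrow> 'a::{real_normed_vector,complete_space} \<Rightarrow>\<^sub>L 'a"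
  assumes "C0_semigroup S"
  obtains B where "\<And>u. u \<in> {0..T} \<Longrightarrow> norm (S u) \<le> B"
proof -
  obtain \<delta> M where "\<delta> > 0" and M: "\<And>u. u \<in> {0..\<delta>} \<Longrightarrow> norm (S u) \<le> M"
    using C0_semigroup_locally_bounded[OF assms] by blast
  define M1 where "M1 = max 1 M"
  have "1 \<le> M1" by (simp add: M1_def)
  have "norm (S u) \<le> M1 ^ Suc n" if "0 \<le> u" "u \<le> real (Suc n) * \<delta>" for n u
    using that
  proof (induction n arbitrary: u)
    case 0
    then have "norm (S u) \<le> M" using M by simp
    then show ?case unfolding M1_def by simp
  next
    case (Suc n)
    show ?case
    proof (cases "u \<le> \<delta>")
      case True
      then have "norm (S u) \<le> M" using M Suc.prems by simp
      then have "norm (S u) \<le> M1" unfolding M1_def by linarith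
      also have "\<dots> \<le> M1 ^ Suc (Suc n)"
        using power_increasing[of 1 "Suc (Suc n)" M1] \<open>1 \<le> M1\<close> by simp
      finally show ?thesis .
    next
      case False
      have "S u = S \<delta> o\<^sub>L S (u - \<delta>)"
        using C0_semigroup_add[OF assms, of \<delta> "u - \<delta>"] False \<open>\<delta> > 0\<close> by simp
      then have "norm (S u) \<le> norm (S \<delta>) * norm (S (u - \<delta>))"
        by (simp add: norm_blinfun_compose)
      also have "\<dots> \<le> M1 * M1 ^ Suc n"
      proof (rule mult_mono)
        have "norm (S \<delta>) \<le> M" using M \<open>\<delta> > 0\<close> by simp
        then show "norm (S \<delta>) \<le> M1" unfolding M1_def by linarith
        show "norm (S (u - \<delta>)) \<le> M1 ^ Suc n"
          using Suc.IH[of "u - \<delta>"] Suc.prems False by (simp add: algebra_simps)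
      qed (use \<open>1 \<le> M1\<close> in auto)
      finally show ?thesis by simp
    qed
  qed
  moreover obtain n where "T / \<delta> \<le> real n" using real_arch_simple by blast
  then have "T \<le> real (Suc n) * \<delta>" using \<open>\<delta> > 0\<close> by (simp add: divide_le_eq algebra_simps)
  ultimately show thesis using that[of "M1 ^ Suc n"] by auto
qed

lemma strongly_continuous_on_compact_bounded:
  fixes R :: "real \<Rightarrow> 'a::{real_normed_vector,complete_space} \<Rightarrow>\<^sub>L 'a"
  assumes "strongly_continuous_on I R" and "compact I"
  obtains C where "\<And>u. u \<in> I \<Longrightarrow> norm (R u) \<le> C"
proof -
  have "bounded ((\<lambda>u. R u y) ` I)" for y
    using assms compact_continuous_image compact_imp_bounded
    unfolding strongly_continuous_on_def by blast
  then have "bounded (R ` I)" by (rule uniform_boundedness)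
  then show thesis using that by (auto simp: bounded_iff)
qed

locale semigroup_kernel_resolvent =
  fixes S :: "real \<Rightarrow> 'a::{real_inner,complete_space} \<Rightarrow>\<^sub>L 'a" and K :: "real \<Rightarrow> real"
    and R :: "real \<Rightarrow> 'a \<Rightarrow>\<^sub>L 'a" and T B C :: real
  assumes semigroup: "C0_semigroup S"
    and norm_S_le: "\<And>u. u \<in> {0..T} \<Longrightarrow> norm (S u) \<le> B"
    and K_absolutely_integrable: "K absolutely_integrable_on {0..T}"
    and R_strongly_continuous: "strongly_continuous_on {0..T} R"
    and norm_R_le: "\<And>u. u \<in> {0..T} \<Longrightarrow> norm (R u) \<le> C"
begin

lemma norm_S_apply_le: "0 \<le> u \<Longrightarrow> u \<le> T \<Longrightarrow> norm (S u y) \<le> B * norm y"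
  using norm_blinfun[of "S u" y] norm_S_le[of u]
  by (meson atLeastAtMost_iff mult_right_mono norm_ge_zero order_trans)

lemma norm_R_apply_le: "0 \<le> u \<Longrightarrow> u \<le> T \<Longrightarrow> norm (R u y) \<le> C * norm y"
  using norm_blinfun[of "R u" y] norm_R_le[of u]
  by (meson atLeastAtMost_iff mult_right_mono norm_ge_zero order_trans)

lemma B_nonneg: "0 \<le> T \<Longrightarrow> 0 \<le> B"
  using norm_S_le[of 0] norm_ge_zero[of "S 0"] by (simp del: norm_ge_zero)

lemma C_nonneg: "0 \<le> T \<Longrightarrow> 0 \<le> C"
  using norm_R_le[of 0] norm_ge_zero[of "R 0"] by (simp del: norm_ge_zero)

lemma S_split: "0 \<le> v \<Longrightarrow> v \<le> u \<Longrightarrow> S u y = S v (S (u - v) y)"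
  using C0_semigroup_add[OF semigroup, of v "u - v"] by simp

lemma norm_S_diff_le:
  assumes "0 \<le> v" "v \<le> u" "u \<le> T"
  shows "norm (S u y - S v y) \<le> B * norm (S (u - v) y - y)"
proof -
  have "S u y - S v y = S v (S (u - v) y - y)"
    using S_split[OF assms(1,2)] by (simp add: blinfun.diff_right)
  then show ?thesis using norm_S_apply_le[of v] assms by simp
qed

lemma S_near_identity: "e > 0 \<Longrightarrow> \<exists>d>0. \<forall>h. 0 \<le> h \<longrightarrow> h < d \<longrightarrow> norm (S h y - y) < e"
  using tendstoD[OF C0_semigroup_tendsto[OF semigroup, of y]] C0_semigroup_zero[OF semigroup]
  unfolding eventually_at_right_field by (fastforce simp: dist_norm le_less)

lemma S_uniformly_continuous: "uniformly_continuous_on {0..T} (\<lambda>u. S u y)"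
proof (rule uniformly_continuous_on_real_ordered)
  fix e :: real assume "e > 0"
  then obtain d where "d > 0" and d: "\<forall>h. 0 \<le> h \<longrightarrow> h < d \<longrightarrow> norm (S h y - y) < e / (\<bar>B\<bar> + 1)"
    using S_near_identity[of "e / (\<bar>B\<bar> + 1)"] by (auto simp: add_nonneg_pos)
  have "norm (S u y - S v y) < e" if "0 \<le> v" "v \<le> u" "u \<le> T" "u - v < d" for u v
  proof -
    have "0 \<le> B" using B_nonneg that by simp
    have "norm (S u y - S v y) \<le> B * norm (S (u - v) y - y)" by (rule norm_S_diff_le[OF that(1-3)])
    also have "\<dots> \<le> B * (e / (\<bar>B\<bar> + 1))"
      using d that \<open>0 \<le> B\<close> by (intro mult_left_mono) (auto simp: less_imp_le)
    also have "\<dots> < e" using \<open>e > 0\<close> \<open>0 \<le> B\<close> by (simp add: field_simps)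
    finally show ?thesis .
  qed
  then show "\<exists>d>0. \<forall>u\<in>{0..T}. \<forall>v\<in>{0..T}. v \<le> u \<longrightarrow> u - v < d \<longrightarrow> dist (S u y) (S v y) < e"
    using \<open>d > 0\<close> by (auto simp: dist_norm)
qed

lemma continuous_on_S_shift:
  "\<tau> \<le> c \<Longrightarrow> d - \<tau> \<le> T \<Longrightarrow> continuous_on {c..d} (\<lambda>s. S (s - \<tau>) y)"
  by (rule continuous_on_compose2[OF uniformly_continuous_imp_continuous[OF S_uniformly_continuous]])
    (auto intro!: continuous_intros)

lemma continuous_on_R_reflect:
  assumes "0 \<le> t - d" "t - c \<le> T"
  shows "continuous_on {c..d} (\<lambda>s. R (t - s) y)"
proof (rule continuous_on_compose2[of "{0..T}" "\<lambda>u. R u y"])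
  show "continuous_on {0..T} (\<lambda>u. R u y)"
    using R_strongly_continuous by (simp add: strongly_continuous_on_def)
qed (use assms in \<open>auto intro!: continuous_intros\<close>)

lemma K_absolutely_integrable_on: "0 \<le> c \<Longrightarrow> d \<le> T \<Longrightarrow> K absolutely_integrable_on {c..d}"
  by (rule absolutely_integrable_on_subinterval[OF K_absolutely_integrable]) auto

lemma K_integrable_on: "0 \<le> c \<Longrightarrow> d \<le> T \<Longrightarrow> K integrable_on {c..d}"
  and abs_K_integrable_on: "0 \<le> c \<Longrightarrow> d \<le> T \<Longrightarrow> (\<lambda>u. \<bar>K u\<bar>) integrable_on {c..d}"
  using K_absolutely_integrable_on by (auto simp: absolutely_integrable_on_def)

lemma integrable_K_S:
  assumes "0 \<le> c" "d \<le> T" "d \<le> e" "e - c \<le> T"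
  shows "(\<lambda>u. K u *\<^sub>R S (e - u) y) integrable_on {c..d}"
proof -
  have "continuous_on {c..d} (\<lambda>u. S (e - u) y)"
    using assms by (intro continuous_on_compose2[OF uniformly_continuous_imp_continuous[OF S_uniformly_continuous]])
      (auto intro!: continuous_intros)
  then show ?thesis
    using integrable_scaleR_continuous[where K=K and a=c and b=d] K_absolutely_integrable_on[OF assms(1,2)] by simp
qed

lemma norm_integral_K_S_le:
  assumes "0 \<le> c" "d \<le> T" "d \<le> e" "e - c \<le> T"
  shows "norm (integral {c..d} (\<lambda>u. K u *\<^sub>R S (e - u) y)) \<le> B * norm y * integral {c..d} (\<lambda>u. \<bar>K u\<bar>)"
proof -
  have "norm (integral {c..d} (\<lambda>u. K u *\<^sub>R S (e - u) y)) \<le> integral {c..d} (\<lambda>u. B * norm y * \<bar>K u\<bar>)"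
  proof (rule integral_norm_bound_integral_inner[OF integrable_K_S[OF assms]])
    show "(\<lambda>u. B * norm y * \<bar>K u\<bar>) integrable_on {c..d}"
      using abs_K_integrable_on[OF assms(1,2)] by (rule integrable_on_mult_right)
    fix u assume "u \<in> {c..d}"
    then have "norm (S (e - u) y) \<le> B * norm y" using assms by (intro norm_S_apply_le) auto
    then show "norm (K u *\<^sub>R S (e - u) y) \<le> B * norm y * \<bar>K u\<bar>"
      by (simp add: mult_left_mono mult.commute)
  qed
  then show ?thesis by simp
qed

end

section \<open>The operators \<mu>, F, G and M\<close>

context semigroup_kernel_resolvent
begin

lemma S_apply_mu:
  assumes "0 \<le> a" "0 \<le> r" "a + r \<le> T"
  shows "S a (mu_op S K r y) = integral {0..r} (\<lambda>u. K u *\<^sub>R S (a + r - u) y)"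
proof -
  have "S a (mu_op S K r y) = integral {0..r} (\<lambda>u. S a (K u *\<^sub>R S (r - u) y))"
    unfolding mu_op_def using assms
    by (intro integral_linear[OF integrable_K_S blinfun.bounded_linear_right, symmetric, unfolded o_def])
      auto
  also have "\<dots> = integral {0..r} (\<lambda>u. K u *\<^sub>R S (a + r - u) y)"
  proof (rule integral_cong)
    fix u assume "u \<in> {0..r}"
    then have "S (a + r - u) y = S a (S (r - u) y)" using assms S_split[of a "a + r - u"] by simp
    then show "S a (K u *\<^sub>R S (r - u) y) = K u *\<^sub>R S (a + r - u) y"
      by (simp add: blinfun.scaleR_right)
  qed
  finally show ?thesis .
qed

lemma mu_increment:
  assumes "0 \<le> r" "0 \<le> a" "r + a \<le> T"
  shows "mu_op S K (r + a) y - S a (mu_op S K r y) = integral {r..r + a} (\<lambda>u. K u *\<^sub>R S (r + a - u) y)"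
proof -
  have "mu_op S K (r + a) y = integral {0..r} (\<lambda>u. K u *\<^sub>R S (r + a - u) y)
      + integral {r..r + a} (\<lambda>u. K u *\<^sub>R S (r + a - u) y)"
    unfolding mu_op_def using assms
    by (intro integral_combine_inner integrable_K_S) auto
  moreover have "S a (mu_op S K r y) = integral {0..r} (\<lambda>u. K u *\<^sub>R S (r + a - u) y)"
    using S_apply_mu[of a r y] assms by (simp add: add.commute)
  ultimately show ?thesis by simp
qed

lemma S_mu_commute:
  assumes "0 \<le> h" "0 \<le> r" "h + r \<le> T"
  shows "S h (mu_op S K r y) = mu_op S K r (S h y)"
proof -
  have "S h (mu_op S K r y) = integral {0..r} (\<lambda>u. K u *\<^sub>R S (h + r - u) y)"
    by (rule S_apply_mu[OF assms])
  also have "\<dots> = mu_op S K r (S h y)"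
    unfolding mu_op_def
  proof (rule integral_cong)
    fix u assume "u \<in> {0..r}"
    then have "S (h + r - u) y = S (r - u) (S h y)" using S_split[of "r - u" "h + r - u"] assms by simp
    then show "K u *\<^sub>R S (h + r - u) y = K u *\<^sub>R S (r - u) (S h y)" by simp
  qed
  finally show ?thesis .
qed

lemma mu_diff:
  assumes "0 \<le> r" "r \<le> T"
  shows "mu_op S K r (y - z) = mu_op S K r y - mu_op S K r z"
proof -
  have "mu_op S K r y - mu_op S K r z = integral {0..r} (\<lambda>u. K u *\<^sub>R S (r - u) y - K u *\<^sub>R S (r - u) z)"
    unfolding mu_op_def using assms by (intro integral_diff[symmetric] integrable_K_S) auto
  then show ?thesis unfolding mu_op_def by (simp add: blinfun.diff_right scaleR_diff_right)
qed

lemma norm_mu_le: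
  assumes "0 \<le> r" "r \<le> T"
  shows "norm (mu_op S K r y) \<le> B * norm y * integral {0..T} (\<lambda>u. \<bar>K u\<bar>)"
proof -
  have "norm (mu_op S K r y) \<le> B * norm y * integral {0..r} (\<lambda>u. \<bar>K u\<bar>)"
    unfolding mu_op_def using assms by (intro norm_integral_K_S_le) auto
  also have "\<dots> \<le> B * norm y * integral {0..T} (\<lambda>u. \<bar>K u\<bar>)"
    using assms B_nonneg abs_K_integrable_on
    by (intro mult_left_mono integral_subset_le) auto
  finally show ?thesis .
qed

lemma norm_mu_diff_le:
  assumes "0 \<le> v" "v \<le> u" "u \<le> T"
  shows "norm (mu_op S K u y - mu_op S K v y)
    \<le> B * norm y * integral {v..u} (\<lambda>w. \<bar>K w\<bar>) + B * norm (S (u - v) y - y) * integral {0..T} (\<lambda>w. \<bar>K w\<bar>)"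
proof -
  let ?a = "mu_op S K u y - S (u - v) (mu_op S K v y)" and ?b = "mu_op S K v (S (u - v) y - y)"
  have split: "mu_op S K u y - mu_op S K v y = ?a + ?b"
    using S_mu_commute[of "u - v" v y] mu_diff[of v "S (u - v) y" y] assms by simp
  moreover have "norm ?a \<le> B * norm y * integral {v..u} (\<lambda>w. \<bar>K w\<bar>)"
    using mu_increment[of v "u - v" y] norm_integral_K_S_le[of v u u y] assms by simp
  moreover have "norm ?b \<le> B * norm (S (u - v) y - y) * integral {0..T} (\<lambda>w. \<bar>K w\<bar>)"
    using norm_mu_le assms by simp
  ultimately show ?thesis unfolding split using norm_triangle_ineq[of ?a ?b] by linarith
qed

lemma mu_uniformly_continuous: "uniformly_continuous_on {0..T} (\<lambda>r. mu_op S K r y)"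
proof (rule uniformly_continuous_on_real_ordered)
  fix e :: real assume "e > 0"
  define W where "W = integral {0..T} (\<lambda>w. \<bar>K w\<bar>)"
  define e' where "e' = e / (\<bar>B\<bar> * norm y + \<bar>B\<bar> * \<bar>W\<bar> + 1)"
  have "e' > 0" using \<open>e > 0\<close> by (simp add: e'_def add_nonneg_pos)
  obtain d1 where "d1 > 0" and d1: "\<And>u v. 0 \<le> v \<Longrightarrow> v \<le> u \<Longrightarrow> u \<le> T \<Longrightarrow> u - v < d1 \<Longrightarrow>
      \<bar>integral {v..u} (\<lambda>w. \<bar>K w\<bar>)\<bar> < e'"
    using integral_over_short_intervals_small[OF abs_K_integrable_on \<open>e' > 0\<close>] by auto
  obtain d2 where "d2 > 0" and d2: "\<forall>h. 0 \<le> h \<longrightarrow> h < d2 \<longrightarrow> norm (S h y - y) < e'"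
    using S_near_identity[OF \<open>e' > 0\<close>] by blast
  have close: "norm (mu_op S K u y - mu_op S K v y) < e"
    if "0 \<le> v" "v \<le> u" "u \<le> T" "u - v < min d1 d2" for u v
  proof -
    have "0 \<le> B" using B_nonneg that by simp
    have "0 \<le> W" unfolding W_def using that abs_K_integrable_on by (intro integral_nonneg) auto
    have "integral {v..u} (\<lambda>w. \<bar>K w\<bar>) \<le> e'" using d1[OF that(1-3)] that by simp
    then have "B * norm y * integral {v..u} (\<lambda>w. \<bar>K w\<bar>) \<le> B * norm y * e'"
      using \<open>0 \<le> B\<close> by (intro mult_left_mono) auto
    moreover have "norm (S (u - v) y - y) \<le> e'" using d2 that by (simp add: less_imp_le)
    then have "B * norm (S (u - v) y - y) * W \<le> B * e' * W"
      using \<open>0 \<le> B\<close> \<open>0 \<le> W\<close> by (intro mult_right_mono mult_left_mono) auto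
    ultimately have "norm (mu_op S K u y - mu_op S K v y) \<le> (B * norm y + B * W) * e'"
      using norm_mu_diff_le[OF that(1-3), of y] unfolding W_def by (simp add: algebra_simps)
    also have "\<dots> < e"
    proof -
      define N where "N = B * norm y + B * W"
      have "0 \<le> N" using \<open>0 \<le> B\<close> \<open>0 \<le> W\<close> by (simp add: N_def)
      have "e' = e / (N + 1)" using \<open>0 \<le> B\<close> \<open>0 \<le> W\<close> by (simp add: e'_def N_def)
      then have "e' + N * e' = e" using \<open>0 \<le> N\<close> by (simp add: field_simps)
      then have "N * e' < e" using \<open>e' > 0\<close> by linarith
      then show ?thesis by (simp add: N_def)
    qed
    finally show ?thesis .
  qed
  then show "\<exists>d>0. \<forall>u\<in>{0..T}. \<forall>v\<in>{0..T}. v \<le> u \<longrightarrow> u - v < d \<longrightarrow> dist (mu_op S K u y) (mu_op S K v y) < e"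
    using \<open>d1 > 0\<close> \<open>d2 > 0\<close> by (auto simp: dist_norm intro!: exI[of _ "min d1 d2"])
qed

lemma continuous_on_R_apply:
  assumes "0 \<le> t - d" "t - c \<le> T" "continuous_on {c..d} u"
  shows "continuous_on {c..d} (\<lambda>s. R (t - s) (u s))"
proof (rule continuous_on_blinfun_apply_family[where L="\<lambda>s. R (t - s)" and M=C])
  show "continuous_on {c..d} (\<lambda>s. R (t - s) y)" for y
    using assms(1,2) by (rule continuous_on_R_reflect)
  show "norm (R (t - s)) \<le> C" if "s \<in> {c..d}" for s
    using that assms(1,2) by (intro norm_R_le) auto
qed (rule assms(3))

lemma integrable_R_apply:
  assumes "0 \<le> t - d" "t - c \<le> T" "continuous_on {c..d} u"
  shows "(\<lambda>s. R (t - s) (u s)) integrable_on {c..d}"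
  using integrable_continuous_complete[OF continuous_on_R_apply[OF assms, folded box_real(2)]]
  by (simp only: box_real(2))

lemma norm_integral_R_apply_le:
  assumes "c \<le> d" "0 \<le> t - d" "t - c \<le> T" "continuous_on {c..d} u"
    and bound: "\<And>s. s \<in> {c..d} \<Longrightarrow> norm (u s) \<le> M"
  shows "norm (integral {c..d} (\<lambda>s. R (t - s) (u s))) \<le> C * M * (d - c)"
proof -
  have "norm (integral {c..d} (\<lambda>s. R (t - s) (u s))) \<le> integral {c..d} (\<lambda>s. C * M)"
  proof (rule integral_norm_bound_integral_inner[OF integrable_R_apply[OF assms(2-4)]])
    fix s assume "s \<in> {c..d}"
    then have "norm (R (t - s) (u s)) \<le> C * norm (u s)" using assms by (intro norm_R_apply_le) auto
    also have "\<dots> \<le> C * M" using bound[OF \<open>s \<in> {c..d}\<close>] C_nonneg assms by (intro mult_left_mono) auto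
    finally show "norm (R (t - s) (u s)) \<le> C * M" .
  qed (rule integrable_const_ivl)
  then show ?thesis using assms(1) by (simp add: mult.commute mult.left_commute)
qed

lemma integrable_R_S:
  "0 \<le> \<tau> \<Longrightarrow> \<tau> \<le> c \<Longrightarrow> d \<le> t \<Longrightarrow> t \<le> T \<Longrightarrow> (\<lambda>s. R (t - s) (S (s - \<tau>) y)) integrable_on {c..d}"
  by (intro integrable_R_apply continuous_on_S_shift) auto

lemma norm_F_le:
  assumes "0 \<le> \<tau>" "\<tau> \<le> t" "t \<le> T"
  shows "norm (F_op S R t \<tau> y) \<le> (B + T * C * B) * norm y"
proof -
  have "0 \<le> B" "0 \<le> C" using B_nonneg C_nonneg assms by auto
  have "norm (integral {\<tau>..t} (\<lambda>s. R (t - s) (S (s - \<tau>) y))) \<le> C * (B * norm y) * (t - \<tau>)"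
    using assms by (intro norm_integral_R_apply_le continuous_on_S_shift norm_S_apply_le) auto
  also have "\<dots> \<le> C * (B * norm y) * T"
    using assms \<open>0 \<le> B\<close> \<open>0 \<le> C\<close> by (intro mult_left_mono) auto
  finally have "norm (integral {\<tau>..t} (\<lambda>s. R (t - s) (S (s - \<tau>) y))) \<le> T * C * B * norm y"
    by (simp add: algebra_simps)
  moreover have "norm (S (t - \<tau>) y) \<le> B * norm y" using assms by (intro norm_S_apply_le) auto
  ultimately show ?thesis
    unfolding F_op_def using norm_triangle_ineq4 by (smt (verit) distrib_right)
qed

lemma bounded_linear_F:
  assumes "0 \<le> \<tau>" "\<tau> \<le> t" "t \<le> T"
  shows "bounded_linear (F_op S R t \<tau>)"
proof (rule bounded_linear_intro)
  show "F_op S R t \<tau> (y + z) = F_op S R t \<tau> y + F_op S R t \<tau> z" for y z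
  proof -
    have "integral {\<tau>..t} (\<lambda>s. R (t - s) (S (s - \<tau>) (y + z)))
        = integral {\<tau>..t} (\<lambda>s. R (t - s) (S (s - \<tau>) y)) + integral {\<tau>..t} (\<lambda>s. R (t - s) (S (s - \<tau>) z))"
      using assms by (simp add: blinfun.add_right integral_add integrable_R_S)
    then show ?thesis by (simp add: F_op_def blinfun.add_right)
  qed
  show "F_op S R t \<tau> (a *\<^sub>R y) = a *\<^sub>R F_op S R t \<tau> y" for a y
    by (simp add: F_op_def blinfun.scaleR_right scaleR_diff_right)
  show "norm (F_op S R t \<tau> y) \<le> norm y * (B + T * C * B)" for y
    using norm_F_le[OF assms] by (simp add: mult.commute)
qed

lemma F_increment:
  assumes "0 \<le> \<tau>" "0 \<le> h" "\<tau> + h \<le> t" "t \<le> T"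
  shows "F_op S R t (\<tau> + h) y - F_op S R t \<tau> y
    = (S (t - (\<tau> + h)) y - S (t - \<tau>) y)
      - integral {\<tau> + h..t} (\<lambda>s. R (t - s) (S (s - (\<tau> + h)) y - S (s - \<tau>) y))
      + integral {\<tau>..\<tau> + h} (\<lambda>s. R (t - s) (S (s - \<tau>) y))"
proof -
  have "integral {\<tau>..t} (\<lambda>s. R (t - s) (S (s - \<tau>) y))
      = integral {\<tau>..\<tau> + h} (\<lambda>s. R (t - s) (S (s - \<tau>) y)) + integral {\<tau> + h..t} (\<lambda>s. R (t - s) (S (s - \<tau>) y))"
    using assms by (intro integral_combine_inner integrable_R_S) auto
  moreover have "integral {\<tau> + h..t} (\<lambda>s. R (t - s) (S (s - (\<tau> + h)) y - S (s - \<tau>) y))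
      = integral {\<tau> + h..t} (\<lambda>s. R (t - s) (S (s - (\<tau> + h)) y)) - integral {\<tau> + h..t} (\<lambda>s. R (t - s) (S (s - \<tau>) y))"
    using assms by (simp add: blinfun.diff_right integral_diff integrable_R_S)
  ultimately show ?thesis by (simp add: F_op_def algebra_simps)
qed

lemma norm_F_increment_le:
  assumes "0 \<le> \<tau>" "0 \<le> h" "\<tau> + h \<le> t" "t \<le> T"
  shows "norm (F_op S R t (\<tau> + h) y - F_op S R t \<tau> y)
    \<le> (B + T * C * B) * norm (S h y - y) + h * (C * (B * norm y))"
proof -
  have "0 \<le> B" "0 \<le> C" using B_nonneg C_nonneg assms by auto
  have S_shift: "norm (S (s - (\<tau> + h)) y - S (s - \<tau>) y) \<le> B * norm (S h y - y)" if "\<tau> + h \<le> s" "s \<le> T" for s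
    using norm_S_diff_le[of "s - (\<tau> + h)" "s - \<tau>" y] that assms by (simp add: norm_minus_commute)
  have "norm (integral {\<tau> + h..t} (\<lambda>s. R (t - s) (S (s - (\<tau> + h)) y - S (s - \<tau>) y)))
      \<le> C * (B * norm (S h y - y)) * (t - (\<tau> + h))"
    using assms S_shift
    by (intro norm_integral_R_apply_le continuous_on_diff continuous_on_S_shift) auto
  also have "\<dots> \<le> C * (B * norm (S h y - y)) * T"
    using assms \<open>0 \<le> B\<close> \<open>0 \<le> C\<close> by (intro mult_left_mono) auto
  finally have middle: "norm (integral {\<tau> + h..t} (\<lambda>s. R (t - s) (S (s - (\<tau> + h)) y - S (s - \<tau>) y)))
      \<le> T * C * B * norm (S h y - y)" by (simp add: algebra_simps)
  have "norm (integral {\<tau>..\<tau> + h} (\<lambda>s. R (t - s) (S (s - \<tau>) y))) \<le> C * (B * norm y) * (\<tau> + h - \<tau>)"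
    using assms by (intro norm_integral_R_apply_le continuous_on_S_shift norm_S_apply_le) auto
  then have last: "norm (integral {\<tau>..\<tau> + h} (\<lambda>s. R (t - s) (S (s - \<tau>) y))) \<le> C * (B * norm y) * h"
    by simp
  have first: "norm (S (t - (\<tau> + h)) y - S (t - \<tau>) y) \<le> B * norm (S h y - y)"
    using S_shift assms by simp
  show ?thesis
    unfolding F_increment[OF assms]
    using first middle last norm_triangle_ineq4 norm_triangle_ineq
    by (smt (verit, best) distrib_right mult.commute)
qed

lemma F_tendsto_right:
  assumes "0 \<le> \<tau>" "\<tau> < t" "t \<le> T"
  shows "((\<lambda>h. F_op S R t (\<tau> + h) y) \<longlongrightarrow> F_op S R t \<tau> y) (at_right 0)"
proof -
  let ?P = "B + T * C * B" and ?Q = "C * (B * norm y)"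
  have "((\<lambda>h. F_op S R t (\<tau> + h) y - F_op S R t \<tau> y) \<longlongrightarrow> 0) (at_right 0)"
  proof (rule Lim_null_comparison)
    show "\<forall>\<^sub>F h in at_right 0. norm (F_op S R t (\<tau> + h) y - F_op S R t \<tau> y) \<le> ?P * norm (S h y - y) + h * ?Q"
      unfolding eventually_at_right_field using assms
      by (intro exI[of _ "t - \<tau>"]) (auto intro!: norm_F_increment_le)
    have "((\<lambda>h. norm (S h y - y)) \<longlongrightarrow> 0) (at_right 0)"
      using tendsto_norm_zero[OF LIM_zero[OF C0_semigroup_tendsto[OF semigroup]]] .
    moreover have "((\<lambda>h. h) \<longlongrightarrow> 0) (at_right (0::real))" by (rule tendsto_ident_at)
    ultimately show "((\<lambda>h. ?P * norm (S h y - y) + h * ?Q) \<longlongrightarrow> 0) (at_right 0)"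
      by (intro tendsto_add_zero tendsto_mult_right_zero tendsto_mult_left_zero)
  qed
  then show ?thesis by (simp add: LIM_zero_iff)
qed


lemma G_eq_integral:
  assumes "0 \<le> \<sigma>" "\<sigma> \<le> \<tau>" "\<tau> \<le> s" "s \<le> T"
  shows "G_op S K s \<sigma> \<tau> x = integral {\<tau> - \<sigma>..s - \<sigma>} (\<lambda>u. K u *\<^sub>R S (s - \<sigma> - u) x)"
  using mu_increment[of "\<tau> - \<sigma>" "s - \<tau>" x] assms unfolding G_op_def by simp

lemma norm_G_le:
  assumes "0 \<le> \<sigma>" "\<sigma> \<le> \<tau>" "\<tau> \<le> s" "s \<le> T"
  shows "norm (G_op S K s \<sigma> \<tau> x) \<le> B * norm x * integral {\<tau> - \<sigma>..s - \<sigma>} (\<lambda>u. \<bar>K u\<bar>)"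
  unfolding G_eq_integral[OF assms] using assms by (intro norm_integral_K_S_le) auto

lemma continuous_on_G:
  assumes "0 \<le> \<sigma>" "\<sigma> \<le> \<tau>" "\<tau> \<le> c" "d \<le> T"
  shows "continuous_on {c..d} (\<lambda>s. G_op S K s \<sigma> \<tau> x)"
  unfolding G_op_def
proof (intro continuous_on_diff continuous_on_S_shift)
  show "continuous_on {c..d} (\<lambda>s. mu_op S K (s - \<sigma>) x)"
    using assms
    by (intro continuous_on_compose2[OF uniformly_continuous_imp_continuous[OF mu_uniformly_continuous]])
      (auto intro!: continuous_intros)
qed (use assms in auto)

lemma G_increment:
  assumes "0 \<le> \<sigma>" "\<sigma> \<le> \<tau>\<^sub>0" "\<tau>\<^sub>0 \<le> \<tau>\<^sub>1" "\<tau>\<^sub>1 \<le> s"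
  shows "G_op S K s \<sigma> \<tau>\<^sub>1 x - G_op S K s \<sigma> \<tau>\<^sub>0 x
    = - S (s - \<tau>\<^sub>1) (mu_op S K (\<tau>\<^sub>1 - \<sigma>) x - S (\<tau>\<^sub>1 - \<tau>\<^sub>0) (mu_op S K (\<tau>\<^sub>0 - \<sigma>) x))"
  using S_split[of "s - \<tau>\<^sub>1" "s - \<tau>\<^sub>0" "mu_op S K (\<tau>\<^sub>0 - \<sigma>) x"] assms
  by (simp add: G_op_def blinfun.diff_right)

lemma M_increment:
  assumes "0 \<le> \<sigma>" "\<sigma> \<le> \<tau>\<^sub>0" "\<tau>\<^sub>0 \<le> \<tau>\<^sub>1" "\<tau>\<^sub>1 \<le> t" "t \<le> T"
  shows "M_op S K R t \<sigma> \<tau>\<^sub>1 x - M_op S K R t \<sigma> \<tau>\<^sub>0 x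
    = - F_op S R t \<tau>\<^sub>1 (mu_op S K (\<tau>\<^sub>1 - \<sigma>) x - S (\<tau>\<^sub>1 - \<tau>\<^sub>0) (mu_op S K (\<tau>\<^sub>0 - \<sigma>) x))
      + integral {\<tau>\<^sub>0..\<tau>\<^sub>1} (\<lambda>s. R (t - s) (G_op S K s \<sigma> \<tau>\<^sub>0 x))"
proof -
  define w where "w = mu_op S K (\<tau>\<^sub>1 - \<sigma>) x - S (\<tau>\<^sub>1 - \<tau>\<^sub>0) (mu_op S K (\<tau>\<^sub>0 - \<sigma>) x)"
  have int: "(\<lambda>s. R (t - s) (G_op S K s \<sigma> \<tau> x)) integrable_on {c..d}"
    if "\<sigma> \<le> \<tau>" "\<tau> \<le> c" "d \<le> t" for \<tau> c d
    using that assms by (intro integrable_R_apply continuous_on_G) auto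
  have "integral {\<tau>\<^sub>0..t} (\<lambda>s. R (t - s) (G_op S K s \<sigma> \<tau>\<^sub>0 x))
      = integral {\<tau>\<^sub>0..\<tau>\<^sub>1} (\<lambda>s. R (t - s) (G_op S K s \<sigma> \<tau>\<^sub>0 x))
        + integral {\<tau>\<^sub>1..t} (\<lambda>s. R (t - s) (G_op S K s \<sigma> \<tau>\<^sub>0 x))"
    using assms by (intro integral_combine_inner int) auto
  moreover have "integral {\<tau>\<^sub>1..t} (\<lambda>s. R (t - s) (G_op S K s \<sigma> \<tau>\<^sub>1 x))
      - integral {\<tau>\<^sub>1..t} (\<lambda>s. R (t - s) (G_op S K s \<sigma> \<tau>\<^sub>0 x))
      = - integral {\<tau>\<^sub>1..t} (\<lambda>s. R (t - s) (S (s - \<tau>\<^sub>1) w))"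
  proof -
    have "integral {\<tau>\<^sub>1..t} (\<lambda>s. R (t - s) (G_op S K s \<sigma> \<tau>\<^sub>1 x))
        - integral {\<tau>\<^sub>1..t} (\<lambda>s. R (t - s) (G_op S K s \<sigma> \<tau>\<^sub>0 x))
        = integral {\<tau>\<^sub>1..t} (\<lambda>s. R (t - s) (G_op S K s \<sigma> \<tau>\<^sub>1 x - G_op S K s \<sigma> \<tau>\<^sub>0 x))"
      using assms by (simp add: blinfun.diff_right integral_diff int)
    also have "\<dots> = integral {\<tau>\<^sub>1..t} (\<lambda>s. - R (t - s) (S (s - \<tau>\<^sub>1) w))"
      using assms by (intro integral_cong) (simp add: G_increment w_def blinfun.minus_right)
    finally show ?thesis by simp
  qed
  moreover have "G_op S K t \<sigma> \<tau>\<^sub>1 x - G_op S K t \<sigma> \<tau>\<^sub>0 x = - S (t - \<tau>\<^sub>1) w"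
    unfolding w_def using assms by (intro G_increment) auto
  ultimately show ?thesis
    unfolding w_def[symmetric] by (simp add: M_op_def F_op_def algebra_simps)
qed

lemma norm_mu_increment_sub_le:
  assumes "0 \<le> c" "0 \<le> h" "c + h \<le> T"
    and near: "\<And>v. 0 \<le> v \<Longrightarrow> v \<le> h \<Longrightarrow> norm (S v x - x) \<le> \<eta>"
  shows "norm (mu_op S K (c + h) x - S h (mu_op S K c x) - integral {c..c + h} K *\<^sub>R x)
    \<le> \<eta> * integral {c..c + h} (\<lambda>u. \<bar>K u\<bar>)"
proof -
  have int: "(\<lambda>u. K u *\<^sub>R S (c + h - u) x) integrable_on {c..c + h}"
    using assms by (intro integrable_K_S) auto
  have K_int: "K integrable_on {c..c + h}" using assms by (intro K_integrable_on) auto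
  have K_scaleR: "integral {c..c + h} (\<lambda>u. K u *\<^sub>R x) = integral {c..c + h} K *\<^sub>R x"
    by (rule integral_unique[OF has_integral_scaleR_left[OF integrable_integral[OF K_int]]])
  have "mu_op S K (c + h) x - S h (mu_op S K c x) - integral {c..c + h} K *\<^sub>R x
      = integral {c..c + h} (\<lambda>u. K u *\<^sub>R S (c + h - u) x - K u *\<^sub>R x)"
    using mu_increment[of c h x] assms
    by (simp add: integral_diff[OF int integrable_on_scaleR_left[OF K_int]] K_scaleR)
  also have "norm \<dots> \<le> integral {c..c + h} (\<lambda>u. \<eta> * \<bar>K u\<bar>)"
  proof (rule integral_norm_bound_integral_inner)
    show "(\<lambda>u. K u *\<^sub>R S (c + h - u) x - K u *\<^sub>R x) integrable_on {c..c + h}"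
      by (rule integrable_diff[OF int integrable_on_scaleR_left[OF K_int]])
    show "(\<lambda>u. \<eta> * \<bar>K u\<bar>) integrable_on {c..c + h}"
      using assms by (intro integrable_on_mult_right abs_K_integrable_on) auto
    fix u assume "u \<in> {c..c + h}"
    then have "\<bar>K u\<bar> * norm (S (c + h - u) x - x) \<le> \<bar>K u\<bar> * \<eta>"
      by (intro mult_left_mono near) auto
    then show "norm (K u *\<^sub>R S (c + h - u) x - K u *\<^sub>R x) \<le> \<eta> * \<bar>K u\<bar>"
      by (simp add: scaleR_diff_right[symmetric] mult.commute)
  qed
  finally show ?thesis by simp
qed

lemma mu_increment_quotient_tendsto:
  assumes inside: "\<forall>\<^sub>F h in at_right 0. 0 \<le> a h \<and> a h + h \<le> T"
    and lim_K: "((\<lambda>h. integral {a h..a h + h} K / h) \<longlongrightarrow> k) (at_right 0)"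
    and lim_abs_K: "((\<lambda>h. integral {a h..a h + h} (\<lambda>u. \<bar>K u\<bar>) / h) \<longlongrightarrow> \<bar>k\<bar>) (at_right 0)"
  shows "((\<lambda>h. (mu_op S K (a h + h) x - S h (mu_op S K (a h) x)) /\<^sub>R h) \<longlongrightarrow> k *\<^sub>R x) (at_right 0)"
proof -
  let ?q = "\<lambda>h. (mu_op S K (a h + h) x - S h (mu_op S K (a h) x) - integral {a h..a h + h} K *\<^sub>R x) /\<^sub>R h"
  have "(?q \<longlongrightarrow> 0) (at_right 0)"
  proof (rule tendstoI)
    fix e :: real assume "e > 0"
    define \<eta> where "\<eta> = e / (\<bar>k\<bar> + 2)"
    have "\<eta> > 0" using \<open>e > 0\<close> by (simp add: \<eta>_def add_nonneg_pos)
    obtain d where "d > 0" and d: "\<forall>v. 0 \<le> v \<longrightarrow> v < d \<longrightarrow> norm (S v x - x) < \<eta>"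
      using S_near_identity[OF \<open>\<eta> > 0\<close>] by blast
    have "\<forall>\<^sub>F h in at_right 0. h < d" using \<open>d > 0\<close> by (auto simp: eventually_at_right_field)
    moreover have "\<forall>\<^sub>F h in at_right 0. integral {a h..a h + h} (\<lambda>u. \<bar>K u\<bar>) / h < \<bar>k\<bar> + 1"
      using order_tendstoD(2)[OF lim_abs_K] by simp
    moreover have "\<forall>\<^sub>F h in at_right (0::real). 0 < h" by (simp add: eventually_at_right_less)
    ultimately show "\<forall>\<^sub>F h in at_right 0. dist (?q h) 0 < e"
      using inside
    proof eventually_elim
      case (elim h)
      have "norm (mu_op S K (a h + h) x - S h (mu_op S K (a h) x) - integral {a h..a h + h} K *\<^sub>R x)
          \<le> \<eta> * integral {a h..a h + h} (\<lambda>u. \<bar>K u\<bar>)"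
        using elim d by (intro norm_mu_increment_sub_le) auto
      then have "norm (?q h) \<le> \<eta> * integral {a h..a h + h} (\<lambda>u. \<bar>K u\<bar>) / h"
        using \<open>0 < h\<close> by (simp add: divide_right_mono divide_inverse_commute)
      also have "\<dots> \<le> \<eta> * (\<bar>k\<bar> + 1)"
        using elim \<open>\<eta> > 0\<close> by (simp add: mult_left_mono times_divide_eq_right[symmetric] del: times_divide_eq_right)
      also have "\<dots> < e" using \<open>e > 0\<close> by (simp add: \<eta>_def field_simps)
      finally show ?case by simp
    qed
  qed
  moreover have "((\<lambda>h. (integral {a h..a h + h} K / h) *\<^sub>R x) \<longlongrightarrow> k *\<^sub>R x) (at_right 0)"
    using lim_K by (rule tendsto_scaleR[OF _ tendsto_const])
  ultimately have "((\<lambda>h. ?q h + (integral {a h..a h + h} K / h) *\<^sub>R x) \<longlongrightarrow> 0 + k *\<^sub>R x) (at_right 0)"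
    by (rule tendsto_add)
  then show ?thesis by (simp add: scaleR_diff_right divide_inverse_commute)
qed

lemma norm_integral_R_G_le:
  assumes "0 \<le> \<sigma>" "\<sigma> \<le> \<tau>\<^sub>0" "\<tau>\<^sub>0 \<le> \<tau>\<^sub>1" "\<tau>\<^sub>1 \<le> t" "t \<le> T"
  shows "norm (integral {\<tau>\<^sub>0..\<tau>\<^sub>1} (\<lambda>s. R (t - s) (G_op S K s \<sigma> \<tau>\<^sub>0 x)))
    \<le> C * (B * norm x * integral {\<tau>\<^sub>0 - \<sigma>..\<tau>\<^sub>1 - \<sigma>} (\<lambda>u. \<bar>K u\<bar>)) * (\<tau>\<^sub>1 - \<tau>\<^sub>0)"
proof (rule norm_integral_R_apply_le)
  show "continuous_on {\<tau>\<^sub>0..\<tau>\<^sub>1} (\<lambda>s. G_op S K s \<sigma> \<tau>\<^sub>0 x)"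
    using assms by (intro continuous_on_G) auto
  fix s assume s: "s \<in> {\<tau>\<^sub>0..\<tau>\<^sub>1}"
  have "norm (G_op S K s \<sigma> \<tau>\<^sub>0 x) \<le> B * norm x * integral {\<tau>\<^sub>0 - \<sigma>..s - \<sigma>} (\<lambda>u. \<bar>K u\<bar>)"
    using assms s by (intro norm_G_le) auto
  also have "\<dots> \<le> B * norm x * integral {\<tau>\<^sub>0 - \<sigma>..\<tau>\<^sub>1 - \<sigma>} (\<lambda>u. \<bar>K u\<bar>)"
    using assms s B_nonneg by (intro mult_left_mono integral_subset_le abs_K_integrable_on) auto
  finally show "norm (G_op S K s \<sigma> \<tau>\<^sub>0 x) \<le> B * norm x * integral {\<tau>\<^sub>0 - \<sigma>..\<tau>\<^sub>1 - \<sigma>} (\<lambda>u. \<bar>K u\<bar>)" .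
qed (use assms in auto)

lemma M_difference_quotient:
  assumes "0 \<le> \<sigma>" "\<sigma> \<le> \<tau>\<^sub>0" "0 < h" "\<tau>\<^sub>0 + h \<le> t" "t \<le> T"
  shows "(M_op S K R t \<sigma> (\<tau>\<^sub>0 + h) x - M_op S K R t \<sigma> \<tau>\<^sub>0 x) /\<^sub>R h
    = - F_op S R t (\<tau>\<^sub>0 + h) ((mu_op S K (\<tau>\<^sub>0 - \<sigma> + h) x - S h (mu_op S K (\<tau>\<^sub>0 - \<sigma>) x)) /\<^sub>R h)
      + integral {\<tau>\<^sub>0..\<tau>\<^sub>0 + h} (\<lambda>s. R (t - s) (G_op S K s \<sigma> \<tau>\<^sub>0 x)) /\<^sub>R h"
proof -
  let ?v = "mu_op S K (\<tau>\<^sub>0 - \<sigma> + h) x - S h (mu_op S K (\<tau>\<^sub>0 - \<sigma>) x)"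
  have shift: "\<tau>\<^sub>0 + h - \<sigma> = \<tau>\<^sub>0 - \<sigma> + h" by simp
  have "M_op S K R t \<sigma> (\<tau>\<^sub>0 + h) x - M_op S K R t \<sigma> \<tau>\<^sub>0 x
      = - F_op S R t (\<tau>\<^sub>0 + h) ?v + integral {\<tau>\<^sub>0..\<tau>\<^sub>0 + h} (\<lambda>s. R (t - s) (G_op S K s \<sigma> \<tau>\<^sub>0 x))"
    using M_increment[of \<sigma> \<tau>\<^sub>0 "\<tau>\<^sub>0 + h" t x] assms unfolding shift by simp
  moreover have "F_op S R t (\<tau>\<^sub>0 + h) (?v /\<^sub>R h) = F_op S R t (\<tau>\<^sub>0 + h) ?v /\<^sub>R h"
    using assms by (intro linear_scale bounded_linear.linear bounded_linear_F) auto
  ultimately show ?thesis by (simp add: scaleR_add_right scaleR_diff_right)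
qed

lemma norm_F_diff_le:
  assumes "0 \<le> \<tau>" "\<tau> \<le> t" "t \<le> T"
  shows "norm (F_op S R t \<tau> y - F_op S R t \<tau> z) \<le> (B + T * C * B) * norm (y - z)"
  using norm_F_le[OF assms, of "y - z"] linear_diff[OF bounded_linear.linear[OF bounded_linear_F[OF assms]]]
  by simp

lemma R_G_quotient_tendsto:
  assumes "0 \<le> \<sigma>" "t \<le> T"
    and inside: "\<forall>\<^sub>F h in at_right 0. \<sigma> \<le> \<tau>\<^sub>0 h \<and> \<tau>\<^sub>0 h + h \<le> t"
    and lim_abs_K: "((\<lambda>h. integral {\<tau>\<^sub>0 h - \<sigma>..\<tau>\<^sub>0 h - \<sigma> + h} (\<lambda>u. \<bar>K u\<bar>) / h) \<longlongrightarrow> c) (at_right 0)"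
  shows "((\<lambda>h. integral {\<tau>\<^sub>0 h..\<tau>\<^sub>0 h + h} (\<lambda>s. R (t - s) (G_op S K s \<sigma> (\<tau>\<^sub>0 h) x)) /\<^sub>R h)
    \<longlongrightarrow> 0) (at_right 0)"
proof (rule Lim_null_comparison)
  let ?I = "\<lambda>h. integral {\<tau>\<^sub>0 h - \<sigma>..\<tau>\<^sub>0 h - \<sigma> + h} (\<lambda>u. \<bar>K u\<bar>) / h"
  let ?J = "\<lambda>h. integral {\<tau>\<^sub>0 h..\<tau>\<^sub>0 h + h} (\<lambda>s. R (t - s) (G_op S K s \<sigma> (\<tau>\<^sub>0 h) x))"
  have "\<forall>\<^sub>F h in at_right (0::real). 0 < h" by (simp add: eventually_at_right_less)
  then show "\<forall>\<^sub>F h in at_right 0. norm (?J h /\<^sub>R h) \<le> C * B * norm x * (h * ?I h)"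
    using inside
  proof eventually_elim
    case (elim h)
    have shift: "\<tau>\<^sub>0 h + h - \<sigma> = \<tau>\<^sub>0 h - \<sigma> + h" by simp
    have "norm (?J h) \<le> C * (B * norm x * (h * ?I h)) * h"
      using norm_integral_R_G_le[of \<sigma> "\<tau>\<^sub>0 h" "\<tau>\<^sub>0 h + h" t x] elim assms(1,2)
      unfolding shift by simp
    then have "norm (?J h) / h \<le> C * (B * norm x * (h * ?I h))"
      by (simp only: pos_divide_le_eq[OF \<open>0 < h\<close>])
    then show ?case using \<open>0 < h\<close> by (simp add: divide_inverse_commute mult.assoc)
  qed
  have "((\<lambda>h. h * ?I h) \<longlongrightarrow> 0 * c) (at_right 0)"
    by (intro tendsto_mult tendsto_ident_at lim_abs_K)
  then show "((\<lambda>h. C * B * norm x * (h * ?I h)) \<longlongrightarrow> 0) (at_right 0)"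
    using tendsto_mult_right_zero by fastforce
qed

lemma M_quotient_tendsto:
  assumes "0 \<le> \<sigma>" "t \<le> T"
    and inside: "\<forall>\<^sub>F h in at_right 0. \<sigma> \<le> \<tau>\<^sub>0 h \<and> \<tau>\<^sub>0 h + h \<le> t"
    and lim_K: "((\<lambda>h. integral {\<tau>\<^sub>0 h - \<sigma>..\<tau>\<^sub>0 h - \<sigma> + h} K / h) \<longlongrightarrow> k) (at_right 0)"
    and lim_abs_K: "((\<lambda>h. integral {\<tau>\<^sub>0 h - \<sigma>..\<tau>\<^sub>0 h - \<sigma> + h} (\<lambda>u. \<bar>K u\<bar>) / h) \<longlongrightarrow> \<bar>k\<bar>) (at_right 0)"
    and lim_F: "((\<lambda>h. F_op S R t (\<tau>\<^sub>0 h + h) (k *\<^sub>R x)) \<longlongrightarrow> F_op S R t \<tau> (k *\<^sub>R x)) (at_right 0)"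
  shows "((\<lambda>h. (M_op S K R t \<sigma> (\<tau>\<^sub>0 h + h) x - M_op S K R t \<sigma> (\<tau>\<^sub>0 h) x) /\<^sub>R h)
    \<longlongrightarrow> - F_op S R t \<tau> (k *\<^sub>R x)) (at_right 0)"
proof -
  define w where "w h = (mu_op S K (\<tau>\<^sub>0 h - \<sigma> + h) x - S h (mu_op S K (\<tau>\<^sub>0 h - \<sigma>) x)) /\<^sub>R h" for h
  have pos: "\<forall>\<^sub>F h in at_right (0::real). 0 < h" by (simp add: eventually_at_right_less)
  have "(w \<longlongrightarrow> k *\<^sub>R x) (at_right 0)"
    unfolding w_def using inside assms(1,2)
    by (intro mu_increment_quotient_tendsto lim_K lim_abs_K) (auto elim: eventually_mono)
  moreover have "\<forall>\<^sub>F h in at_right 0. \<forall>y. norm (F_op S R t (\<tau>\<^sub>0 h + h) y - F_op S R t (\<tau>\<^sub>0 h + h) (k *\<^sub>R x))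
      \<le> (B + T * C * B) * norm (y - k *\<^sub>R x)"
    using inside pos by eventually_elim (use assms(1,2) in \<open>auto intro!: norm_F_diff_le\<close>)
  ultimately have "((\<lambda>h. F_op S R t (\<tau>\<^sub>0 h + h) (w h)) \<longlongrightarrow> F_op S R t \<tau> (k *\<^sub>R x)) (at_right 0)"
    by (intro tendsto_apply_equi_lipschitz[where L="\<lambda>h. F_op S R t (\<tau>\<^sub>0 h + h)", OF lim_F])
  then have "((\<lambda>h. - F_op S R t (\<tau>\<^sub>0 h + h) (w h)
      + integral {\<tau>\<^sub>0 h..\<tau>\<^sub>0 h + h} (\<lambda>s. R (t - s) (G_op S K s \<sigma> (\<tau>\<^sub>0 h) x)) /\<^sub>R h)
      \<longlongrightarrow> - F_op S R t \<tau> (k *\<^sub>R x) + 0) (at_right 0)"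
    using R_G_quotient_tendsto[OF assms(1,2) inside lim_abs_K] by (intro tendsto_add tendsto_minus)
  moreover have "\<forall>\<^sub>F h in at_right 0. - F_op S R t (\<tau>\<^sub>0 h + h) (w h)
      + integral {\<tau>\<^sub>0 h..\<tau>\<^sub>0 h + h} (\<lambda>s. R (t - s) (G_op S K s \<sigma> (\<tau>\<^sub>0 h) x)) /\<^sub>R h
      = (M_op S K R t \<sigma> (\<tau>\<^sub>0 h + h) x - M_op S K R t \<sigma> (\<tau>\<^sub>0 h) x) /\<^sub>R h"
    using inside pos by eventually_elim (use assms(1,2) in \<open>simp add: M_difference_quotient w_def\<close>)
  ultimately show ?thesis by (simp add: tendsto_cong)
qed

lemma M_has_vector_derivative:
  assumes "0 \<le> \<sigma>" "\<sigma> < \<tau>" "\<tau> < t" "t \<le> T"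
    and right_K: "((\<lambda>h. integral {\<tau> - \<sigma>..\<tau> - \<sigma> + h} K / h) \<longlongrightarrow> K (\<tau> - \<sigma>)) (at_right 0)"
    and right_abs_K: "((\<lambda>h. integral {\<tau> - \<sigma>..\<tau> - \<sigma> + h} (\<lambda>u. \<bar>K u\<bar>) / h) \<longlongrightarrow> \<bar>K (\<tau> - \<sigma>)\<bar>) (at_right 0)"
    and left_K: "((\<lambda>h. integral {\<tau> - \<sigma> - h..\<tau> - \<sigma>} K / h) \<longlongrightarrow> K (\<tau> - \<sigma>)) (at_right 0)"
    and left_abs_K: "((\<lambda>h. integral {\<tau> - \<sigma> - h..\<tau> - \<sigma>} (\<lambda>u. \<bar>K u\<bar>) / h) \<longlongrightarrow> \<bar>K (\<tau> - \<sigma>)\<bar>) (at_right 0)"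
  shows "((\<lambda>\<tau>'. M_op S K R t \<sigma> \<tau>' x) has_vector_derivative - F_op S R t \<tau> (K (\<tau> - \<sigma>) *\<^sub>R x)) (at \<tau>)"
proof (rule has_vector_derivative_at_if_one_sided_quotients)
  have "\<forall>\<^sub>F h in at_right 0. \<sigma> \<le> \<tau> \<and> \<tau> + h \<le> t"
    using assms unfolding eventually_at_right_field by (intro exI[of _ "t - \<tau>"]) auto
  then show "((\<lambda>h. (M_op S K R t \<sigma> (\<tau> + h) x - M_op S K R t \<sigma> \<tau> x) /\<^sub>R h)
      \<longlongrightarrow> - F_op S R t \<tau> (K (\<tau> - \<sigma>) *\<^sub>R x)) (at_right 0)"
    using M_quotient_tendsto[where \<tau>\<^sub>0="\<lambda>_. \<tau>"] assms F_tendsto_right by simp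
  have "\<forall>\<^sub>F h in at_right 0. \<sigma> \<le> \<tau> - h \<and> \<tau> - h + h \<le> t"
    using assms unfolding eventually_at_right_field by (intro exI[of _ "\<tau> - \<sigma>"]) auto
  moreover have shift: "\<tau> - \<sigma> - h = \<tau> - h - \<sigma>" for h by simp
  ultimately show "((\<lambda>h. (M_op S K R t \<sigma> \<tau> x - M_op S K R t \<sigma> (\<tau> - h) x) /\<^sub>R h)
      \<longlongrightarrow> - F_op S R t \<tau> (K (\<tau> - \<sigma>) *\<^sub>R x)) (at_right 0)"
    using M_quotient_tendsto[where \<tau>\<^sub>0="\<lambda>h. \<tau> - h" and \<tau>=\<tau> and k="K (\<tau> - \<sigma>)"] assms(1,4) left_K left_abs_K
    unfolding shift by simp
qed


lemma M_has_vector_derivative_AE: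
  assumes "0 \<le> \<sigma>" "\<sigma> \<le> t" "t \<le> T"
  shows "AE \<tau> in lborel. \<tau> \<in> {\<sigma>..t} \<longrightarrow>
    ((\<lambda>\<tau>'. M_op S K R t \<sigma> \<tau>' x) has_vector_derivative (- F_op S R t \<tau> (K (\<tau> - \<sigma>) *\<^sub>R x)))
      (at \<tau> within {\<sigma>..t})"
proof -
  obtain N1 where "negligible N1" and N1:
    "\<And>r. r \<in> {0<..<T} - N1 \<Longrightarrow> ((\<lambda>h. integral {r..r + h} K / h) \<longlongrightarrow> K r) (at_right 0)"
    "\<And>r. r \<in> {0<..<T} - N1 \<Longrightarrow> ((\<lambda>h. integral {r - h..r} K / h) \<longlongrightarrow> K r) (at_right 0)"
    using lebesgue_differentiation_real[OF K_integrable_on[of 0 T]] by auto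
  obtain N2 where "negligible N2" and N2:
    "\<And>r. r \<in> {0<..<T} - N2 \<Longrightarrow> ((\<lambda>h. integral {r..r + h} (\<lambda>u. \<bar>K u\<bar>) / h) \<longlongrightarrow> \<bar>K r\<bar>) (at_right 0)"
    "\<And>r. r \<in> {0<..<T} - N2 \<Longrightarrow> ((\<lambda>h. integral {r - h..r} (\<lambda>u. \<bar>K u\<bar>) / h) \<longlongrightarrow> \<bar>K r\<bar>) (at_right 0)"
    using lebesgue_differentiation_real[OF abs_K_integrable_on[of 0 T]] by auto
  define N where "N = {\<sigma>, t} \<union> (+) \<sigma> ` (N1 \<union> N2)"
  have "negligible N"
    unfolding N_def using \<open>negligible N1\<close> \<open>negligible N2\<close> by (intro negligible_Un negligible_translation) auto
  moreover have "((\<lambda>\<tau>'. M_op S K R t \<sigma> \<tau>' x) has_vector_derivative (- F_op S R t \<tau> (K (\<tau> - \<sigma>) *\<^sub>R x)))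
      (at \<tau> within {\<sigma>..t})" if "\<tau> \<in> {\<sigma>..t} - N" for \<tau>
  proof -
    have "\<sigma> < \<tau>" "\<tau> < t" using that by (auto simp: N_def)
    then have r1: "\<tau> - \<sigma> \<in> {0<..<T} - N1" and r2: "\<tau> - \<sigma> \<in> {0<..<T} - N2"
      using that assms \<open>\<sigma> < \<tau>\<close> \<open>\<tau> < t\<close> by (force simp: N_def)+
    have "((\<lambda>\<tau>'. M_op S K R t \<sigma> \<tau>' x) has_vector_derivative (- F_op S R t \<tau> (K (\<tau> - \<sigma>) *\<^sub>R x))) (at \<tau>)"
      using assms(1) \<open>\<sigma> < \<tau>\<close> \<open>\<tau> < t\<close> assms(3) N1(1)[OF r1] N2(1)[OF r2] N1(2)[OF r1] N2(2)[OF r2]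
      by (rule M_has_vector_derivative)
    then show ?thesis by (rule has_vector_derivative_at_within)
  qed
  ultimately have "AE \<tau> in lebesgue. \<tau> \<in> {\<sigma>..t} \<longrightarrow>
      ((\<lambda>\<tau>'. M_op S K R t \<sigma> \<tau>' x) has_vector_derivative (- F_op S R t \<tau> (K (\<tau> - \<sigma>) *\<^sub>R x)))
        (at \<tau> within {\<sigma>..t})"
    unfolding eventually_ae_filter_negligible by (intro exI[of _ N]) auto
  then show ?thesis by (simp add: AE_completion_iff)
qed

end

theorem propositionA6:
  fixes S :: "real \<Rightarrow> ('a::{real_inner, complete_space} \<Rightarrow>\<^sub>L 'a)"
    and K :: "real \<Rightarrow> real"
    and R :: "real \<Rightarrow> ('a \<Rightarrow>\<^sub>L 'a)"
    and T t \<sigma> :: real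
    and x :: 'a
  assumes "C0_semigroup S"
    and "T > 0"
    and "K measurable_on {0..T}"
    and "(\<lambda>s. (K s)\<^sup>2) integrable_on {0..T}"
    and "strongly_continuous_on {0..T} R"
    and "resolvent_eq S K T R"
    and "\<And>R'. strongly_continuous_on {0..T} R' \<Longrightarrow> resolvent_eq S K T R'
            \<Longrightarrow> \<forall>s\<in>{0..T}. R' s = R s"
    and "0 \<le> \<sigma>" and "\<sigma> \<le> t" and "t \<le> T"
    and "x \<in> generator_domain S"
  shows "AE \<tau> in lborel. \<tau> \<in> {\<sigma>..t} \<longrightarrow>
           ((\<lambda>\<tau>'. M_op S K R t \<sigma> \<tau>' x)
              has_vector_derivative (- F_op S R t \<tau> (K (\<tau> - \<sigma>) *\<^sub>R x)))
             (at \<tau> within {\<sigma>..t})"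
proof -
  obtain B where B: "\<And>u. u \<in> {0..T} \<Longrightarrow> norm (S u) \<le> B"
    using C0_semigroup_bounded_on[OF assms(1)] by blast
  obtain C where C: "\<And>u. u \<in> {0..T} \<Longrightarrow> norm (R u) \<le> C"
    using strongly_continuous_on_compact_bounded[OF assms(5) compact_Icc] by blast
  have K_abs: "K absolutely_integrable_on {0..T}"
    using assms(3,4) by (rule absolutely_integrable_if_square_integrable)
  interpret semigroup_kernel_resolvent S K R T B C
    using assms(1,5) B C K_abs by unfold_locales
  show ?thesis using assms(8-10) by (rule M_has_vector_derivative_AE)
qed

end
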